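(* For every positive integer $n$, the $n$-valued group structure $\mathbb{G}_n(\mathbb{C})$ on $\mathbb{C}$ extends to $\mathbb{C}P^1$ only as a structure of an algebraic $n$-valued coset monoid $\mathbb{M}_n(\mathbb{C}P^1)$ (i.e. it extends to such a monoid, but not to an algebraic $n$-valued group on $\mathbb{C}P^1$). Here the point $\infty$ is absorbing, i.e. $\infty\ast x=x\ast\infty=[\infty,\infty,\dots,\infty]$ for every $x\in\mathbb{C}P^1\setminus\{\infty\}$, while the value $\infty\ast\infty$ is not defined. In homogeneous coordinates the multiplication $\ast:\mathbb{C}P^1\times\mathbb{C}P^1\to\mathrm{Sym}^n(\mathbb{C}P^1)\cong\mathbb{C}P^n$ is given by $$(x_1:x_0)\ast(y_1:y_0)=(b_n:b_{n-1}:\dots:b_0),$$ where $b_j=b_j(x,y)$ is the coefficient of $z_1^{n-j}z_0^{j}$ in the homogeneous polynomial $$(x_0y_0z_0)^n\,p_n\!\left(\frac{z_1}{z_0};(-1)^n\frac{x_1}{x_0},(-1)^n\frac{y_1}{y_0}\right),$$ whenever $(x_1:x_0)$ and $(y_1:y_0)$ are not both equal to $(1:0)$.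
   Context: $\mathbb{C}P^1=\mathbb{C}\cup\{\infty\}$, $x=x_1/x_0$ for $(x_1:x_0)$, $\infty=(1:0)$. $\mathrm{Sym}^n(X)=X^n/\Sigma_n$; elements are multisets. A point $(b_n:\dots:b_0)\in\mathbb{C}P^n$ is identified with the multiset in $\mathrm{Sym}^n(\mathbb{C}P^1)$ of zeros $(z_1:z_0)$ (with multiplicity) of the form $\sum_jb_jz_1^{n-j}z_0^j$. With $\varepsilon=e^{2\pi i/n}$, $p_n(z;x,y)=\prod_{r,s=1}^n(\sqrt[n]{z}+\varepsilon^r\sqrt[n]{x}+\varepsilon^s\sqrt[n]{y})$ (fixed branches of the roots), a symmetric polynomial with integer coefficients. $\mathbb{G}_n(\mathbb{C})$ is the $n$-valued group on $\mathbb{C}$ with $x\ast y=[(\sqrt[n]{x}+\varepsilon^r\sqrt[n]{y})^n\mid r=1,\dots,n]=[z\mid p_n(z;(-1)^nx,(-1)^ny)=0]$, neutral element $0$, inverse $\mathrm{inv}(x)=(-1)^nx$. An algebraic $n$-valued monoid is an algebraic variety $X$ with a rational (possibly partially defined) morphism $\ast:X\times X\to\mathrm{Sym}^n(X)$ which is associative (the $n^2$-multisets $[x\ast w\mid w\in y\ast z]$ and $[w\ast z\mid w\in x\ast y]$ coincide) and has a neutral element $e$: $x\ast e$ and $e\ast x$ are defined and equal $[x,\dots,x]$ for every $x\in X$. An algebraic $n$-valued group is such a monoid with a rational morphism $\mathrm{inv}:X\to X$ such that, whenever $\mathrm{inv}(x)$ exists, $x\ast\mathrm{inv}(x)$ and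 $\mathrm{inv}(x)\ast x$ exist and contain $e$. A coset $n$-valued monoid $M_H$ is obtained from a (1-valued, possibly partially defined) monoid $M$ and a subgroup $H\subset\mathrm{Aut}(M)$ of order $n$, with projection $\pi:M\to M/H$, by $\pi(u)\ast\pi(v)=[\pi(u\cdot h(v))\mid h\in H]$. *)

theory Defs
  imports
    "HOL-Analysis.Analysis"
    "HOL-Computational_Algebra.Computational_Algebra"
    "HOL-Algebra.Bij"
begin

section \<open>The projective line\<close>

definition proj_rel :: "complex \<times> complex \<Rightarrow> complex \<times> complex \<Rightarrow> bool" where
  "proj_rel v w \<longleftrightarrow> v \<noteq> (0, 0) \<and> w \<noteq> (0, 0) \<and> (\<exists>c. c \<noteq> 0 \<and> v = (c * fst w, c * snd w))"

lemma part_equivp_proj_rel: "part_equivp proj_rel"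
proof (rule part_equivpI)
  show "\<exists>v. proj_rel v v"
    by (rule exI[of _ "(1, 0)"]) (auto simp: proj_rel_def intro!: exI[of _ 1])
  show "symp proj_rel"
  proof (rule sympI)
    fix v w assume "proj_rel v w"
    then obtain c where c: "v \<noteq> (0, 0)" "w \<noteq> (0, 0)" "c \<noteq> 0" "v = (c * fst w, c * snd w)"
      unfolding proj_rel_def by blast
    have "w = (inverse c * fst v, inverse c * snd v)"
      using c(3) by (cases w) (simp add: c(4) flip: mult.assoc)
    with c(1-3) show "proj_rel w v"
      unfolding proj_rel_def by (intro conjI exI[of _ "inverse c"]) simp_all
  qed
  show "transp proj_rel"
  proof (rule transpI)
    fix u v w assume "proj_rel u v" "proj_rel v w"
    then obtain c d where "u \<noteq> (0, 0)" "w \<noteq> (0, 0)" "c \<noteq> 0" "d \<noteq> 0"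
      "u = (c * fst v, c * snd v)" "v = (d * fst w, d * snd w)"
      unfolding proj_rel_def by blast
    then show "proj_rel u w"
      unfolding proj_rel_def by (auto intro!: exI[of _ "c * d"])
  qed
qed

quotient_type cp1 = "complex \<times> complex" / partial: proj_rel
  by (rule part_equivp_proj_rel)

text \<open>\<open>pt x1 x0\<close> is the point with homogeneous coordinates \<open>(x1 : x0)\<close>; it is
  meaningful only if \<open>x1\<close> and \<open>x0\<close> are not both zero. The affine coordinate is \<open>x1 / x0\<close>.\<close>

definition pt :: "complex \<Rightarrow> complex \<Rightarrow> cp1" where
  "pt x1 x0 = abs_cp1 (x1, x0)"

definition fin :: "complex \<Rightarrow> cp1" where
  "fin z = pt z 1"

definition infty :: cp1 where
  "infty = pt 1 0"

lemma pt_eq_iff: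
  assumes "(x1, x0) \<noteq> (0, 0)" "(y1, y0) \<noteq> (0, 0)"
  shows "pt x1 x0 = pt y1 y0 \<longleftrightarrow> x1 * y0 = y1 * x0"
proof -
  have refl: "proj_rel v v" if "v \<noteq> (0, 0)" for v
    using that by (auto simp: proj_rel_def intro!: exI[of _ 1])
  have "pt x1 x0 = pt y1 y0 \<longleftrightarrow> proj_rel (x1, x0) (y1, y0)"
    unfolding pt_def using Quotient3_rel[OF Quotient3_cp1] refl assms by blast
  also have "\<dots> \<longleftrightarrow> x1 * y0 = y1 * x0"
  proof
    assume "proj_rel (x1, x0) (y1, y0)"
    then show "x1 * y0 = y1 * x0" by (auto simp: proj_rel_def)
  next
    assume *: "x1 * y0 = y1 * x0"
    show "proj_rel (x1, x0) (y1, y0)"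
    proof (cases "y0 = 0")
      case True
      with * assms have "y1 \<noteq> 0" "x0 = 0" "x1 \<noteq> 0" by auto
      with True show ?thesis by (auto simp: proj_rel_def intro!: exI[of _ "x1 / y1"])
    next
      case False
      with * assms have "x0 \<noteq> 0" by auto
      with False * show ?thesis
        by (auto simp: proj_rel_def field_simps intro!: exI[of _ "x0 / y0"])
    qed
  qed
  finally show ?thesis .
qed

lemma cp1_coords:
  obtains x1 x0 where "(x1, x0) \<noteq> (0, 0)" "p = pt x1 x0"
proof -
  have "proj_rel (rep_cp1 p) (rep_cp1 p)"
    using Quotient3_rep_reflp[OF Quotient3_cp1] .
  then have "rep_cp1 p \<noteq> (0, 0)" by (simp add: proj_rel_def)
  moreover have "p = pt (fst (rep_cp1 p)) (snd (rep_cp1 p))"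
    by (simp add: pt_def Quotient3_abs_rep[OF Quotient3_cp1])
  ultimately show ?thesis
    using that[of "fst (rep_cp1 p)" "snd (rep_cp1 p)"] by simp
qed

lemma cp1_cases:
  obtains (fin) z where "p = fin z" | (infty) "p = infty"
proof -
  obtain x1 x0 where x: "(x1, x0) \<noteq> (0, 0)" "p = pt x1 x0" by (rule cp1_coords)
  show ?thesis
  proof (cases "x0 = 0")
    case True
    then have "p = infty" using x by (simp add: infty_def pt_eq_iff)
    then show ?thesis by (rule infty)
  next
    case False
    then have "p = fin (x1 / x0)" using x by (simp add: fin_def pt_eq_iff)
    then show ?thesis by (rule fin)
  qed
qed

lemma fin_eq_iff [simp]: "fin z = fin w \<longleftrightarrow> z = w"
  by (simp add: fin_def pt_eq_iff)

lemma fin_neq_infty [simp]: "fin z \<noteq> infty" "infty \<noteq> fin z"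
  by (simp_all add: fin_def infty_def pt_eq_iff)


section \<open>Forms, and symmetric powers as projective spaces\<close>

text \<open>\<open>Sym^n(X)\<close> is represented by the multisets over \<open>X\<close> of size \<open>n\<close>. For \<open>b\<close> with
  \<open>b j \<noteq> 0\<close> for some \<open>j \<le> n\<close>, \<open>form_zeros n b\<close> is the multiset of zeros \<open>(z1 : z0)\<close> of the form
  \<open>\<Sum>j\<le>n. b j * z1^(n-j) * z0^j\<close>, i.e. the element of \<open>Sym^n(CP^1)\<close> identified with
  \<open>(b n : \<dots> : b 0)\<close>. Multiplicities are read off in the charts \<open>z0 = 1\<close> (zeros other than
  \<open>(1 : 0)\<close>) and \<open>z1 = 1\<close> (the zero \<open>(1 : 0)\<close>).\<close>

definition form_zeros :: "nat \<Rightarrow> (nat \<Rightarrow> complex) \<Rightarrow> cp1 multiset" where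
  "form_zeros n b =
     image_mset fin (proots (\<Sum>j\<le>n. monom (b j) (n - j)))
     + replicate_mset (order 0 (\<Sum>j\<le>n. monom (b j) j)) infty"

definition hform :: "nat \<Rightarrow> (nat \<Rightarrow> complex) \<Rightarrow> complex \<Rightarrow> complex \<Rightarrow> complex" where
  "hform d c x1 x0 = (\<Sum>i\<le>d. c i * x1 ^ i * x0 ^ (d - i))"

definition bihform ::
  "nat \<Rightarrow> nat \<Rightarrow> (nat \<Rightarrow> nat \<Rightarrow> complex) \<Rightarrow> complex \<Rightarrow> complex \<Rightarrow> complex \<Rightarrow> complex \<Rightarrow> complex" where
  "bihform d e c x1 x0 y1 y0 =
     (\<Sum>i\<le>d. \<Sum>k\<le>e. c i k * x1 ^ i * x0 ^ (d - i) * y1 ^ k * y0 ^ (e - k))"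


section \<open>Rational maps\<close>

text \<open>A rational map is a class of tuples of (bi)homogeneous forms of equal (bi)degree, not all
  zero, two tuples being equivalent if they are proportional. It is taken with its maximal domain:
  it is defined at a point iff some tuple of the class does not vanish there. Partial maps are
  modelled by \<open>option\<close>.\<close>

definition rational_map :: "(cp1 \<Rightarrow> cp1 option) \<Rightarrow> bool" where
  "rational_map f \<longleftrightarrow>
     (\<exists>d F1 F0.
        (\<exists>x1 x0. hform d F1 x1 x0 \<noteq> 0 \<or> hform d F0 x1 x0 \<noteq> 0) \<and>
        (\<forall>x1 x0 q. (x1, x0) \<noteq> (0, 0) \<longrightarrow>
           (f (pt x1 x0) = Some q \<longleftrightarrow>
             (\<exists>d' G1 G0.
                (\<forall>u1 u0. hform d F1 u1 u0 * hform d' G0 u1 u0 = hform d F0 u1 u0 * hform d' G1 u1 u0) \<and>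
                (hform d' G1 x1 x0, hform d' G0 x1 x0) \<noteq> (0, 0) \<and>
                q = pt (hform d' G1 x1 x0) (hform d' G0 x1 x0)))))"

text \<open>Rational maps from \<open>CP^1 \<times> CP^1\<close> to \<open>Sym^n(CP^1)\<close>, the latter identified with
  \<open>CP^n\<close> through \<open>form_zeros\<close>.\<close>

definition rational_multimap :: "nat \<Rightarrow> (cp1 \<Rightarrow> cp1 \<Rightarrow> cp1 multiset option) \<Rightarrow> bool" where
  "rational_multimap n f \<longleftrightarrow>
     (\<exists>d e F.
        (\<exists>x1 x0 y1 y0. \<exists>j\<le>n. bihform d e (F j) x1 x0 y1 y0 \<noteq> 0) \<and>
        (\<forall>x1 x0 y1 y0 A. (x1, x0) \<noteq> (0, 0) \<longrightarrow> (y1, y0) \<noteq> (0, 0) \<longrightarrow>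
           (f (pt x1 x0) (pt y1 y0) = Some A \<longleftrightarrow>
             (\<exists>d' e' G.
                (\<forall>u1 u0 v1 v0. \<forall>i\<le>n. \<forall>j\<le>n.
                   bihform d e (F i) u1 u0 v1 v0 * bihform d' e' (G j) u1 u0 v1 v0 =
                   bihform d e (F j) u1 u0 v1 v0 * bihform d' e' (G i) u1 u0 v1 v0) \<and>
                (\<exists>j\<le>n. bihform d' e' (G j) x1 x0 y1 y0 \<noteq> 0) \<and>
                A = form_zeros n (\<lambda>j. bihform d' e' (G j) x1 x0 y1 y0)))))"


section \<open>Multivalued monoids and groups\<close>

definition nvalued_monoid :: "nat \<Rightarrow> ('a \<Rightarrow> 'a \<Rightarrow> 'a multiset option) \<Rightarrow> 'a \<Rightarrow> bool" where
  "nvalued_monoid n star e \<longleftrightarrow>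
     (\<forall>x y A. star x y = Some A \<longrightarrow> size A = n) \<and>
     (\<forall>x y z A B. star y z = Some A \<longrightarrow> star x y = Some B \<longrightarrow>
        (\<forall>w\<in>#A. star x w \<noteq> None) \<longrightarrow> (\<forall>w\<in>#B. star w z \<noteq> None) \<longrightarrow>
        (\<Sum>w\<in>#A. the (star x w)) = (\<Sum>w\<in>#B. the (star w z))) \<and>
     (\<forall>x. star x e = Some (replicate_mset n x) \<and> star e x = Some (replicate_mset n x))"

definition algebraic_nvalued_monoid ::
  "nat \<Rightarrow> (cp1 \<Rightarrow> cp1 \<Rightarrow> cp1 multiset option) \<Rightarrow> cp1 \<Rightarrow> bool" where
  "algebraic_nvalued_monoid n star e \<longleftrightarrow> rational_multimap n star \<and> nvalued_monoid n star e"

definition algebraic_nvalued_group ::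
  "nat \<Rightarrow> (cp1 \<Rightarrow> cp1 \<Rightarrow> cp1 multiset option) \<Rightarrow> cp1 \<Rightarrow> (cp1 \<Rightarrow> cp1 option) \<Rightarrow> bool" where
  "algebraic_nvalued_group n star e iv \<longleftrightarrow>
     algebraic_nvalued_monoid n star e \<and> rational_map iv \<and>
     (\<forall>x y. iv x = Some y \<longrightarrow>
        (\<exists>A. star x y = Some A \<and> e \<in># A) \<and> (\<exists>A. star y x = Some A \<and> e \<in># A))"


section \<open>Coset monoids\<close>

definition as_onevalued :: "('m \<Rightarrow> 'm \<Rightarrow> 'm option) \<Rightarrow> 'm \<Rightarrow> 'm \<Rightarrow> 'm multiset option" where
  "as_onevalued mul u v = map_option (\<lambda>w. {#w#}) (mul u v)"

definition monoid_aut :: "('m \<Rightarrow> 'm \<Rightarrow> 'm option) \<Rightarrow> 'm \<Rightarrow> ('m \<Rightarrow> 'm) set" where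
  "monoid_aut mul e =
     {h. bij h \<and> h e = e \<and> (\<forall>u v. mul (h u) (h v) = map_option h (mul u v))}"

text \<open>\<open>proj\<close> identifies the orbit set of \<open>H\<close> on \<open>'m\<close> with the carrier \<open>'x\<close>.\<close>

definition is_coset_monoid ::
  "nat \<Rightarrow> ('m \<Rightarrow> 'm \<Rightarrow> 'm option) \<Rightarrow> 'm \<Rightarrow> ('m \<Rightarrow> 'm) set \<Rightarrow> ('m \<Rightarrow> 'x)
     \<Rightarrow> ('x \<Rightarrow> 'x \<Rightarrow> 'x multiset option) \<Rightarrow> 'x \<Rightarrow> bool" where
  "is_coset_monoid n mul eM H proj star e \<longleftrightarrow>
     nvalued_monoid 1 (as_onevalued mul) eM \<and>
     subgroup H (BijGroup UNIV) \<and> H \<subseteq> monoid_aut mul eM \<and> finite H \<and> card H = n \<and>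
     surj proj \<and> (\<forall>u v. proj u = proj v \<longleftrightarrow> (\<exists>h\<in>H. v = h u)) \<and>
     e = proj eM \<and>
     (\<forall>u v. star (proj u) (proj v) =
        (if \<forall>h\<in>H. mul u (h v) \<noteq> None
         then Some (image_mset (\<lambda>h. proj (the (mul u (h v)))) (mset_set H))
         else None))"

text \<open>The covering monoid, the automorphisms and the projection are required to be algebraic too;
  a covering monoid carried by \<open>CP^1\<close> suffices here.\<close>

definition algebraic_nvalued_coset_monoid ::
  "nat \<Rightarrow> (cp1 \<Rightarrow> cp1 \<Rightarrow> cp1 multiset option) \<Rightarrow> cp1 \<Rightarrow> bool" where
  "algebraic_nvalued_coset_monoid n star e \<longleftrightarrow>
     algebraic_nvalued_monoid n star e \<and>
     (\<exists>(mul :: cp1 \<Rightarrow> cp1 \<Rightarrow> cp1 option) eM H (proj :: cp1 \<Rightarrow> cp1).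
        is_coset_monoid n mul eM H proj star e \<and>
        algebraic_nvalued_monoid 1 (as_onevalued mul) eM \<and>
        (\<forall>h\<in>H. rational_map (\<lambda>u. Some (h u))) \<and>
        rational_map (\<lambda>u. Some (proj u)))"


section \<open>The multivalued group on the complex numbers\<close>

definition croot :: "nat \<Rightarrow> complex \<Rightarrow> complex" where
  "croot n z = z powr (1 / of_nat n)"

definition unity_root :: "nat \<Rightarrow> complex" where
  "unity_root n = exp (2 * of_real pi * \<i> / of_nat n)"

definition p_fun :: "nat \<Rightarrow> complex \<Rightarrow> complex \<Rightarrow> complex \<Rightarrow> complex" where
  "p_fun n z x y =
     (\<Prod>r=1..n. \<Prod>s=1..n. croot n z + unity_root n ^ r * croot n x + unity_root n ^ s * croot n y)"

definition G_mult :: "nat \<Rightarrow> complex \<Rightarrow> complex \<Rightarrow> complex multiset" where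
  "G_mult n x y =
     image_mset (\<lambda>r. (croot n x + unity_root n ^ r * croot n y) ^ n) (mset_set {1..n})"

definition extends_G :: "nat \<Rightarrow> (cp1 \<Rightarrow> cp1 \<Rightarrow> cp1 multiset option) \<Rightarrow> bool" where
  "extends_G n star \<longleftrightarrow>
     (\<forall>x y. star (fin x) (fin y) = Some (image_mset fin (G_mult n x y)))"

text \<open>\<open>bihform n n (\<beta> j)\<close> is the coefficient of \<open>z1^(n-j) * z0^j\<close> in the polynomial
  \<open>(x0 * y0 * z0)^n * p_n(z1/z0; (-1)^n * x1/x0, (-1)^n * y1/y0)\<close>. The identity at all points with
  nonzero \<open>x0\<close>, \<open>y0\<close>, \<open>z0\<close> determines \<open>\<beta> j i k\<close> for \<open>i, j, k \<le> n\<close>.\<close>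

definition p_coeffs :: "nat \<Rightarrow> (nat \<Rightarrow> nat \<Rightarrow> nat \<Rightarrow> complex) \<Rightarrow> bool" where
  "p_coeffs n \<beta> \<longleftrightarrow>
     (\<forall>x1 x0 y1 y0 z1 z0. x0 \<noteq> 0 \<longrightarrow> y0 \<noteq> 0 \<longrightarrow> z0 \<noteq> 0 \<longrightarrow>
        (x0 * y0 * z0) ^ n * p_fun n (z1 / z0) ((-1) ^ n * (x1 / x0)) ((-1) ^ n * (y1 / y0)) =
        (\<Sum>j\<le>n. bihform n n (\<beta> j) x1 x0 y1 y0 * z1 ^ (n - j) * z0 ^ j))"

end

theory Submission
  imports Defs
begin

text \<open>
  The map \<open>u \<mapsto> u^n\<close> identifies the orbits of the \<open>n\<close>-th roots of unity on the additive group of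
  complex numbers with the complex numbers, and \<open>G_mult n\<close> is the resulting coset multiplication:
  \<open>x^n * y^n\<close> consists of the \<open>(x + c * y)^n\<close> with \<open>c^n = 1\<close> (\<open>G_mult_powers\<close>). All of this
  extends to the projective line: addition with \<open>\<infinity> + x = \<infinity>\<close> and \<open>\<infinity> + \<infinity>\<close> undefined is a
  partial monoid, the roots of unity still act by automorphisms, and \<open>u \<mapsto> u^n\<close> still
  separates exactly the orbits. Associativity and the neutral element of the extension hold in every
  coset monoid (\<open>coset_monoid_nvalued_monoid\<close>).

  The algebraic part rests on \<open>\<Prod>c. z - (x + c * y)^n\<close>, the product over the roots of unity, of which
  \<open>p_fun\<close> is a disguise. Its coefficients are forms in \<open>x\<close> and \<open>y\<close>, and since replacing \<open>x\<close>
  by \<open>w * x\<close> with \<open>w^n = 1\<close> only permutes the factors, they are forms in \<open>x^n\<close> and \<open>y^n\<close>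
  (\<open>coset_sum_polynomial_expand\<close>). Homogenising gives \<open>n + 1\<close> forms of bidegree \<open>(n, n)\<close> that vanish
  together only at \<open>(\<infinity>, \<infinity>)\<close>; elsewhere they are the coefficients of a form in \<open>(z1, z0)\<close> whose
  multiset of zeros is the product. That point cannot be repaired by choosing other forms for the same rational map:
  along the points with first factor \<open>\<infinity>\<close> the tuple points in the direction of its last entry, while
  along the points \<open>(x, (-1)^n * x)\<close>, where \<open>0\<close> belongs to the product, the last entry vanishes
  (\<open>proportional_mult_form_imp_0_at_infty\<close>). So \<open>\<infinity> * \<infinity>\<close> is undefined.

  A rational multivalued map is determined by its values at finite points, because a multiset of zeros
  determines a form up to a scalar and polynomial functions have no zero divisors
  (\<open>rational_multimap_eqI\<close>); hence the extension is unique. It is not a group: a rational map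
  from the line to itself is defined everywhere, and an inverse \<open>y\<close> of \<open>\<infinity>\<close> would give
  \<open>0 \<in> \<infinity> * y\<close>, although that product is either undefined or consists of copies of \<open>\<infinity>\<close>.
\<close>

section \<open>Roots of unity\<close>

abbreviation unity_roots :: "nat \<Rightarrow> complex set" where
  "unity_roots n \<equiv> {c. c ^ n = 1}"

lemma image_mset_mset_set_eq_sum: "image_mset f (mset_set A) = (\<Sum>a\<in>A. {#f a#})"
  by (induction A rule: infinite_finite_induct) auto

lemma bij_betw_unity_root_powers:
  assumes "n \<ge> 1"
  shows "bij_betw (\<lambda>r. unity_root n ^ r) {1..n} (unity_roots n)"
proof -
  have pow: "unity_root n ^ r = exp (2 * of_real pi * \<i> * of_nat r / of_nat n)" for r
    by (simp add: unity_root_def exp_of_nat_mult[symmetric] mult_ac)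
  have "(\<lambda>r. unity_root n ^ r) ` {1..n} = unity_roots n"
  proof (intro equalityI subsetI)
    fix c assume "c \<in> (\<lambda>r. unity_root n ^ r) ` {1..n}"
    with assms show "c \<in> unity_roots n"
      using complex_root_unity[of n] by (auto simp: pow)
  next
    fix c assume "c \<in> unity_roots n"
    then obtain j where j: "j < n" "c = unity_root n ^ j"
      using complex_roots_unity[OF assms] by (auto simp: pow)
    show "c \<in> (\<lambda>r. unity_root n ^ r) ` {1..n}"
    proof (cases "j = 0")
      case True
      then have "c = unity_root n ^ n"
        using j complex_root_unity_eq_1[OF assms, of n] by (simp add: pow[of n])
      with assms show ?thesis by auto
    next
      case False
      with j show ?thesis by auto
    qed
  qed
  moreover from this have "inj_on (\<lambda>r. unity_root n ^ r) {1..n}"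
    using card_complex_roots_unity[OF assms] by (intro eq_card_imp_inj_on) auto
  ultimately show ?thesis by (simp add: bij_betw_def)
qed

lemma bij_betw_unity_roots_mult:
  assumes "w \<in> unity_roots n" "n \<ge> 1"
  shows "bij_betw (\<lambda>c. w * c) (unity_roots n) (unity_roots n)"
proof -
  have "w \<noteq> 0" using assms by (auto simp: power_0_left)
  then show ?thesis
    using assms by (intro bij_betwI[of _ _ _ "\<lambda>c. c / w"]) (auto simp: power_mult_distrib power_divide)
qed

lemma prod_unity_roots_linear:
  fixes z w :: complex
  assumes "n \<ge> 1"
  shows "(\<Prod>c\<in>unity_roots n. z - c * w) = z ^ n - w ^ n"
proof (cases "w = 0")
  case True
  then show ?thesis using assms by (simp add: card_complex_roots_unity)
next
  case False
  define p :: "complex poly" where "p = monom 1 n - 1"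
  have val: "poly p x = x ^ n - 1" for x by (simp add: p_def poly_monom)
  have deg: "degree p = n" "coeff p n = 1"
  proof -
    show 1: "coeff p n = 1" using assms by (simp add: p_def)
    have "degree p \<le> n" unfolding p_def by (intro degree_diff_le) (auto simp: degree_monom_le)
    with 1 show "degree p = n" by (simp add: le_antisym le_degree)
  qed
  have "rsquarefree p"
    unfolding rsquarefree_roots
    using assms by (auto simp: val) (auto simp: p_def pderiv_diff pderiv_monom poly_monom power_0_left)
  then have "(\<Prod>c | poly p c = 0. [:- c, 1:]) = p"
    using complex_poly_decompose_rsquarefree[of p] deg by simp
  then have "(\<Prod>c\<in>unity_roots n. poly [:- c, 1:] x) = x ^ n - 1" for x
    by (simp only: poly_prod[symmetric] val[symmetric]) (simp add: val)
  then have "(\<Prod>c\<in>unity_roots n. x - c) = x ^ n - 1" for x by simp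
  from this[of "z / w"] have "(\<Prod>c\<in>unity_roots n. w * (z / w - c)) = w ^ n * ((z / w) ^ n - 1)"
    using assms by (simp add: prod.distrib card_complex_roots_unity)
  moreover have "w * (z / w - c) = z - c * w" for c
    using False by (simp add: right_diff_distrib mult.commute)
  ultimately show ?thesis using False by (simp add: right_diff_distrib power_divide mult.commute)
qed

lemma sum_unity_roots_power:
  assumes "n \<ge> 1"
  shows "(\<Sum>c\<in>unity_roots n. c ^ i) = (if n dvd i then of_nat n else 0)"
proof (cases "n dvd i")
  case True
  then obtain k where "i = n * k" ..
  then show ?thesis using assms by (simp add: power_mult card_complex_roots_unity)
next
  case False
  define w where "w = unity_root n"
  have w: "w \<in> unity_roots n"
    using complex_root_unity[of n 1] assms by (simp add: w_def unity_root_def)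
  have "w ^ i = exp (2 * of_real pi * \<i> * of_nat i / of_nat n)"
    by (simp add: w_def unity_root_def exp_of_nat_mult[symmetric] mult_ac)
  then have "w ^ i \<noteq> 1" using False complex_root_unity_eq_1[OF assms, of i] by simp
  moreover have "(\<Sum>c\<in>unity_roots n. c ^ i) = (\<Sum>c\<in>unity_roots n. (w * c) ^ i)"
    by (rule sum.reindex_bij_betw[OF bij_betw_unity_roots_mult[OF w assms], symmetric])
  ultimately have "(\<Sum>c\<in>unity_roots n. c ^ i) = 0"
    by (simp add: power_mult_distrib sum_distrib_left[symmetric])
  with False show ?thesis by simp
qed

lemma croot_power:
  assumes "n \<ge> 1"
  shows "croot n z ^ n = z"
proof (cases "z = 0")
  case True
  then show ?thesis using assms by (simp add: croot_def)
next
  case False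
  then have "croot n z ^ n = exp (of_nat n * (1 / of_nat n * Ln z))"
    by (simp only: croot_def powr_def exp_of_nat_mult if_False)
  with False assms show ?thesis by simp
qed

section \<open>Binary forms\<close>

definition is_hform :: "nat \<Rightarrow> (complex \<Rightarrow> complex \<Rightarrow> complex) \<Rightarrow> bool" where
  "is_hform d f \<longleftrightarrow> (\<exists>c. \<forall>x y. f x y = hform d c x y)"

lemma is_hform_monomial:
  assumes "i + k = d"
  shows "is_hform d (\<lambda>x y. a * x ^ i * y ^ k)"
  unfolding is_hform_def hform_def
  by (rule exI[of _ "\<lambda>l. if l = i then a else 0"])
    (use assms in \<open>auto simp: if_distrib[of "\<lambda>u. u * _"] cong: if_cong\<close>)

lemma is_hform_zero: "is_hform d (\<lambda>x y. 0)"
  unfolding is_hform_def hform_def by (rule exI[of _ "\<lambda>_. 0"]) simp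

lemma is_hform_add:
  assumes "is_hform d f" "is_hform d g"
  shows "is_hform d (\<lambda>x y. f x y + g x y)"
proof -
  from assms obtain a b where "\<forall>x y. f x y = hform d a x y" "\<forall>x y. g x y = hform d b x y"
    by (auto simp: is_hform_def)
  then show ?thesis unfolding is_hform_def hform_def
    by (intro exI[of _ "\<lambda>i. a i + b i"]) (simp add: ring_distribs sum.distrib)
qed

lemma is_hform_sum:
  assumes "\<And>i. i \<in> A \<Longrightarrow> is_hform d (f i)"
  shows "is_hform d (\<lambda>x y. \<Sum>i\<in>A. f i x y)"
  using assms by (induction A rule: infinite_finite_induct) (auto intro: is_hform_zero is_hform_add)

lemma is_hform_mult:
  assumes "is_hform d f" "is_hform e g"
  shows "is_hform (d + e) (\<lambda>x y. f x y * g x y)"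
proof -
  from assms obtain a b where "\<And>x y. f x y = hform d a x y" "\<And>x y. g x y = hform e b x y"
    by (auto simp: is_hform_def)
  then have "(\<lambda>x y. f x y * g x y) =
      (\<lambda>x y. \<Sum>i\<le>d. \<Sum>k\<le>e. (a i * b k) * x ^ (i + k) * y ^ ((d - i) + (e - k)))"
    by (simp only: hform_def sum_product power_add mult_ac)
  moreover have "is_hform (d + e) \<dots>"
    by (intro is_hform_sum is_hform_monomial) auto
  ultimately show ?thesis by simp
qed

lemma is_hform_power: "is_hform d f \<Longrightarrow> is_hform (m * d) (\<lambda>x y. f x y ^ m)"
proof (induction m)
  case 0
  show ?case using is_hform_monomial[of 0 0 0 1] by simp
next
  case (Suc m)
  then show ?case using is_hform_mult[of d f "m * d"] by simp
qed

lemma is_hform_linear_power: "is_hform n (\<lambda>x y. (x + c * y) ^ n)"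
proof -
  have "is_hform 1 (\<lambda>x y. 1 * x ^ 1 * y ^ 0 + c * x ^ 0 * y ^ 1)"
    by (intro is_hform_add is_hform_monomial) auto
  from is_hform_power[OF this, of n] show ?thesis by simp
qed

text \<open>The coefficient of \<open>z^(card C - j)\<close> is, up to sign, the \<open>j\<close>-th elementary symmetric function of
  the forms \<open>f c\<close>, hence itself a form. Building it by multiplying in one factor at a time avoids sums
  over subsets.\<close>

lemma prod_minus_hform_expand:
  assumes "finite C" and f: "\<And>c. c \<in> C \<Longrightarrow> is_hform n (f c)"
  shows "\<exists>B. (\<forall>j. is_hform (n * j) (B j)) \<and>
    (\<forall>x y z. (\<Prod>c\<in>C. z - f c x y) = (\<Sum>j\<le>card C. B j x y * z ^ (card C - j)))"
  using assms
proof (induction C rule: finite_induct)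
  case empty
  show ?case
    by (rule exI[of _ "\<lambda>j x y. if j = 0 then 1 else 0"])
      (use is_hform_monomial[of 0 0 0 1] is_hform_zero in \<open>auto\<close>)
next
  case (insert c C)
  then obtain B where B: "\<And>j. is_hform (n * j) (B j)"
    and eq: "\<And>x y z. (\<Prod>c\<in>C. z - f c x y) = (\<Sum>j\<le>card C. B j x y * z ^ (card C - j))"
    by auto
  define m where "m = card C"
  \<comment> \<open>Comparing coefficients in \<open>(z - f c) * (\<Sum>j. B j * z^(m - j))\<close> gives \<open>B j - f c * B (j - 1)\<close>,
    where the entries outside \<open>0..m\<close> count as zero.\<close>
  define B' where "B' j x y = (if j \<le> m then B j x y else 0)
      + (case j of 0 \<Rightarrow> 0 | Suc i \<Rightarrow> (- 1) * (f c x y * B i x y))" for j x y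
  have neg: "is_hform d (\<lambda>x y. (- 1) * g x y)" if "is_hform d g" for d g
    using is_hform_mult[OF is_hform_monomial[of 0 0 0 "- 1"] that] by simp
  have "is_hform (n * j) (B' j)" for j
  proof -
    have "is_hform (n * j) (\<lambda>x y. if j \<le> m then B j x y else 0)"
      using B by (cases "j \<le> m") (auto intro: is_hform_zero)
    moreover have "is_hform (n * j) (\<lambda>x y. case j of 0 \<Rightarrow> 0 | Suc i \<Rightarrow> (- 1) * (f c x y * B i x y))"
    proof (cases j)
      case (Suc i)
      have "is_hform (n + n * i) (\<lambda>x y. f c x y * B i x y)"
        by (intro is_hform_mult B insert.prems) simp
      from neg[OF this] Suc show ?thesis by simp
    qed (simp add: is_hform_zero)
    ultimately have "is_hform (n * j) (\<lambda>x y. (if j \<le> m then B j x y else 0)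
      + (case j of 0 \<Rightarrow> 0 | Suc i \<Rightarrow> (- 1) * (f c x y * B i x y)))"
      by (rule is_hform_add)
    then show ?thesis by (simp add: B'_def[abs_def])
  qed
  moreover have "(\<Prod>c\<in>insert c C. z - f c x y) =
      (\<Sum>j\<le>card (insert c C). B' j x y * z ^ (card (insert c C) - j))" for x y z
  proof -
    have "(\<Sum>j\<le>Suc m. B' j x y * z ^ (Suc m - j)) =
        (\<Sum>j\<le>Suc m. (if j \<le> m then B j x y else 0) * z ^ (Suc m - j)) +
        (\<Sum>j\<le>Suc m. (case j of 0 \<Rightarrow> 0 | Suc i \<Rightarrow> (- 1) * (f c x y * B i x y)) * z ^ (Suc m - j))"
      by (simp only: B'_def ring_distribs sum.distrib)
    also have "(\<Sum>j\<le>Suc m. (if j \<le> m then B j x y else 0) * z ^ (Suc m - j)) =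
        (\<Sum>j\<le>m. B j x y * z ^ (Suc m - j))" by simp
    also have "\<dots> = z * (\<Sum>j\<le>m. B j x y * z ^ (m - j))"
      by (simp add: sum_distrib_left Suc_diff_le mult_ac)
    also have "(\<Sum>j\<le>Suc m. (case j of 0 \<Rightarrow> 0 | Suc i \<Rightarrow> (- 1) * (f c x y * B i x y)) * z ^ (Suc m - j))
        = - f c x y * (\<Sum>j\<le>m. B j x y * z ^ (m - j))"
      by (subst sum.atMost_Suc_shift) (simp add: sum_distrib_left sum_negf mult_ac)
    finally show ?thesis
      using insert.hyps by (simp add: eq m_def algebra_simps)
  qed
  ultimately show ?case by blast
qed

text \<open>Averaging over the substitutions \<open>x \<mapsto> w * x\<close> with \<open>w^n = 1\<close>, which leave the product unchanged,
  kills the powers of \<open>x\<close> whose exponent is not a multiple of \<open>n\<close>; the degree \<open>n * j\<close> of the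
  coefficient then forces the exponents of \<open>y\<close> to be multiples of \<open>n\<close> as well.\<close>

lemma coset_sum_polynomial_expand:
  assumes "n \<ge> 1"
  shows "\<exists>\<gamma>. \<forall>x y z. (\<Prod>c\<in>unity_roots n. z - (x + c * y) ^ n) =
    (\<Sum>j\<le>n. hform j (\<gamma> j) (x ^ n) (y ^ n) * z ^ (n - j))"
proof -
  have fin: "finite (unity_roots n)" and card: "card (unity_roots n) = n"
    using assms finite_roots_unity[of n] by (auto simp: card_complex_roots_unity)
  obtain B where "\<And>j. is_hform (n * j) (B j)"
    and B: "\<And>x y z. (\<Prod>c\<in>unity_roots n. z - (x + c * y) ^ n) = (\<Sum>j\<le>n. B j x y * z ^ (n - j))"
    using prod_minus_hform_expand[OF fin, of n "\<lambda>c x y. (x + c * y) ^ n", unfolded card]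
      is_hform_linear_power by auto
  then obtain \<alpha> where \<alpha>: "\<And>j x y. B j x y = hform (n * j) (\<alpha> j) x y"
    unfolding is_hform_def by metis
  \<comment> \<open>\<open>w * x + c * y\<close> and \<open>x + (c / w) * y\<close> have the same \<open>n\<close>-th power.\<close>
  have inv: "(\<Prod>c\<in>unity_roots n. z - (w * x + c * y) ^ n) = (\<Prod>c\<in>unity_roots n. z - (x + c * y) ^ n)"
    if w: "w \<in> unity_roots n" for w x y z
  proof -
    have "(\<Prod>c\<in>unity_roots n. z - (w * x + c * y) ^ n) =
        (\<Prod>c\<in>unity_roots n. z - (w * x + (w * c) * y) ^ n)"
      by (rule prod.reindex_bij_betw[OF bij_betw_unity_roots_mult[OF w assms], symmetric])
    also have "\<dots> = (\<Prod>c\<in>unity_roots n. z - (w * (x + c * y)) ^ n)"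
      by (simp add: algebra_simps)
    finally show ?thesis using w by (simp add: power_mult_distrib)
  qed
  have avg: "(\<Sum>w\<in>unity_roots n. B j (w * x) y) = of_nat n * hform j (\<lambda>i. \<alpha> j (n * i)) (x ^ n) (y ^ n)"
    for j x y
  proof -
    have "(\<Sum>w\<in>unity_roots n. B j (w * x) y) =
        (\<Sum>i\<le>n * j. \<Sum>w\<in>unity_roots n. \<alpha> j i * (w * x) ^ i * y ^ (n * j - i))"
      unfolding \<alpha> hform_def by (rule sum.swap)
    also have "\<dots> = (\<Sum>i\<le>n * j. (\<alpha> j i * x ^ i * y ^ (n * j - i)) * (\<Sum>w\<in>unity_roots n. w ^ i))"
      by (simp add: power_mult_distrib sum_distrib_left mult_ac)
    also have "\<dots> = (\<Sum>i\<le>n * j. if n dvd i then of_nat n * (\<alpha> j i * x ^ i * y ^ (n * j - i)) else 0)"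
      by (intro sum.cong) (simp_all add: sum_unity_roots_power[OF assms])
    also have "\<dots> = (\<Sum>i\<in>(\<lambda>i. n * i) ` {..j}. of_nat n * (\<alpha> j i * x ^ i * y ^ (n * j - i)))"
      using assms by (intro sum.mono_neutral_cong_right) (auto simp: dvd_def)
    also have "\<dots> = (\<Sum>i\<le>j. of_nat n * (\<alpha> j (n * i) * x ^ (n * i) * y ^ (n * j - n * i)))"
      using assms by (subst sum.reindex) (auto simp: inj_on_def)
    also have "\<dots> = (\<Sum>i\<le>j. of_nat n * (\<alpha> j (n * i) * (x ^ n) ^ i * (y ^ n) ^ (j - i)))"
      by (simp only: power_mult diff_mult_distrib2[symmetric])
    finally show ?thesis by (simp add: hform_def sum_distrib_left)
  qed
  have "(\<Prod>c\<in>unity_roots n. z - (x + c * y) ^ n) =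
      (\<Sum>j\<le>n. hform j (\<lambda>i. \<alpha> j (n * i)) (x ^ n) (y ^ n) * z ^ (n - j))" for x y z
  proof -
    have "of_nat n * (\<Prod>c\<in>unity_roots n. z - (x + c * y) ^ n) =
        (\<Sum>w\<in>unity_roots n. \<Prod>c\<in>unity_roots n. z - (w * x + c * y) ^ n)"
      using inv card by simp
    also have "\<dots> = (\<Sum>j\<le>n. (\<Sum>w\<in>unity_roots n. B j (w * x) y) * z ^ (n - j))"
      unfolding B by (subst sum.swap) (simp add: sum_distrib_right)
    also have "\<dots> = of_nat n * (\<Sum>j\<le>n. hform j (\<lambda>i. \<alpha> j (n * i)) (x ^ n) (y ^ n) * z ^ (n - j))"
      by (simp add: avg sum_distrib_left mult_ac)
    finally show ?thesis using assms by simp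
  qed
  then show ?thesis by (intro exI[of _ "\<lambda>j i. \<alpha> j (n * i)"]) blast
qed

text \<open>The chosen branches differ from \<open>- x\<close> and \<open>- y\<close> by roots of unity, which the double product absorbs.
  Writing its index pair as \<open>(r, r * c)\<close>, the product over \<open>r\<close> for fixed \<open>c\<close> is
  \<open>z - (x + c * y)^n\<close>.\<close>

lemma p_fun_eq_prod:
  assumes "n \<ge> 1"
  shows "p_fun n z ((- 1) ^ n * x ^ n) ((- 1) ^ n * y ^ n) = (\<Prod>c\<in>unity_roots n. z - (x + c * y) ^ n)"
proof -
  note reindex = prod.reindex_bij_betw[OF bij_betw_unity_root_powers[OF assms]]
  have root: "\<exists>w\<in>unity_roots n. croot n ((- 1) ^ n * x ^ n) = - w * x" for x
  proof (cases "x = 0")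
    case True
    then show ?thesis using assms by (intro bexI[of _ 1]) (auto simp: croot_def)
  next
    case False
    have "(croot n ((- 1) ^ n * x ^ n) / (- x)) ^ n = (- 1) ^ n * x ^ n / (- x) ^ n"
      by (simp only: power_divide croot_power[OF assms])
    with False have "(croot n ((- 1) ^ n * x ^ n) / (- x)) ^ n = 1"
      by (simp flip: power_mult_distrib)
    with False show ?thesis
      by (intro bexI[of _ "croot n ((- 1) ^ n * x ^ n) / (- x)"]) auto
  qed
  obtain u v where u: "u \<in> unity_roots n" "croot n ((- 1) ^ n * x ^ n) = - u * x"
    and v: "v \<in> unity_roots n" "croot n ((- 1) ^ n * y ^ n) = - v * y"
    using root[of x] root[of y] by blast
  have "p_fun n z ((- 1) ^ n * x ^ n) ((- 1) ^ n * y ^ n) =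
      (\<Prod>r\<in>unity_roots n. \<Prod>s\<in>unity_roots n. croot n z + r * (- u * x) + s * (- v * y))"
    unfolding p_fun_def u(2) v(2)
    by (subst reindex[symmetric], rule prod.cong[OF refl], subst reindex[symmetric]) simp
  also have "\<dots> = (\<Prod>r\<in>unity_roots n. \<Prod>s\<in>unity_roots n. croot n z - (u * r) * x - (v * s) * y)"
    by (simp add: algebra_simps)
  also have "\<dots> = (\<Prod>r\<in>unity_roots n. \<Prod>s\<in>unity_roots n. croot n z - r * x - s * y)"
    by (subst (2) prod.reindex_bij_betw[OF bij_betw_unity_roots_mult[OF u(1) assms], symmetric],
        subst (2) prod.reindex_bij_betw[OF bij_betw_unity_roots_mult[OF v(1) assms], symmetric]) simp
  also have "\<dots> = (\<Prod>r\<in>unity_roots n. \<Prod>c\<in>unity_roots n. croot n z - r * (x + c * y))"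
  proof (rule prod.cong[OF refl])
    fix r assume r: "r \<in> unity_roots n"
    show "(\<Prod>s\<in>unity_roots n. croot n z - r * x - s * y) = (\<Prod>c\<in>unity_roots n. croot n z - r * (x + c * y))"
      by (subst prod.reindex_bij_betw[OF bij_betw_unity_roots_mult[OF r assms], symmetric])
        (simp add: algebra_simps)
  qed
  also have "\<dots> = (\<Prod>c\<in>unity_roots n. \<Prod>r\<in>unity_roots n. croot n z - r * (x + c * y))"
    by (rule prod.swap)
  also have "\<dots> = (\<Prod>c\<in>unity_roots n. z - (x + c * y) ^ n)"
    using assms by (simp add: prod_unity_roots_linear croot_power)
  finally show ?thesis .
qed

text \<open>The branches \<open>croot n (x^n)\<close> and \<open>croot n (y^n)\<close> are \<open>u * x\<close> and \<open>v * y\<close> for roots of unity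
  \<open>u\<close> and \<open>v\<close>; the \<open>n\<close>-th power forgets \<open>u\<close>, and \<open>c \<mapsto> v / u * c\<close> only permutes the multiset.\<close>

lemma G_mult_powers:
  assumes "n \<ge> 1"
  shows "G_mult n (x ^ n) (y ^ n) = image_mset (\<lambda>c. (x + c * y) ^ n) (mset_set (unity_roots n))"
proof -
  have root: "\<exists>w\<in>unity_roots n. croot n (x ^ n) = w * x" for x
  proof (cases "x = 0")
    case True
    then show ?thesis using assms by (intro bexI[of _ 1]) (auto simp: croot_def)
  next
    case False
    then show ?thesis
      by (intro bexI[of _ "croot n (x ^ n) / x"]) (auto simp: power_divide croot_power[OF assms])
  qed
  obtain u v where u: "u \<in> unity_roots n" "croot n (x ^ n) = u * x"
    and v: "v \<in> unity_roots n" "croot n (y ^ n) = v * y"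
    using root[of x] root[of y] by blast
  have vu: "v / u \<in> unity_roots n" and nz: "u \<noteq> 0"
    using u v assms by (auto simp: power_divide power_0_left)
  have "G_mult n (x ^ n) (y ^ n) = (\<Sum>c\<in>unity_roots n. {#(u * x + c * (v * y)) ^ n#})"
    unfolding G_mult_def image_mset_mset_set_eq_sum u(2) v(2)
    by (subst sum.reindex_bij_betw[OF bij_betw_unity_root_powers[OF assms], symmetric]) simp
  also have "\<dots> = (\<Sum>c\<in>unity_roots n. {#(x + (v / u * c) * y) ^ n#})"
  proof (rule sum.cong[OF refl])
    fix c
    have "u * x + c * (v * y) = u * (x + (v / u * c) * y)"
      using nz by (simp add: field_simps)
    then show "{#(u * x + c * (v * y)) ^ n#} = {#(x + (v / u * c) * y) ^ n#}"
      using u(1) by (simp add: power_mult_distrib)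
  qed
  also have "\<dots> = (\<Sum>c\<in>unity_roots n. {#(x + c * y) ^ n#})"
    by (rule sum.reindex_bij_betw[OF bij_betw_unity_roots_mult[OF vu assms]])
  finally show ?thesis by (simp add: image_mset_mset_set_eq_sum)
qed

section \<open>Polynomial functions of four variables\<close>

text \<open>A substitute for polynomials in four variables: being polynomial on every line is preserved by the ring
  operations and suffices to transfer the absence of zero divisors from one variable.\<close>

definition poly_on_lines ::
  "(complex \<Rightarrow> complex \<Rightarrow> complex \<Rightarrow> complex \<Rightarrow> complex) \<Rightarrow> bool" where
  "poly_on_lines f \<longleftrightarrow> (\<forall>x1 x0 y1 y0 a1 a0 b1 b0. \<exists>p. \<forall>t.
     f (x1 + t * a1) (x0 + t * a0) (y1 + t * b1) (y0 + t * b0) = poly p t)"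

lemma poly_on_lines_const: "poly_on_lines (\<lambda>_ _ _ _. c)"
  unfolding poly_on_lines_def by (intro allI exI[of _ "[:c:]"]) simp

lemma poly_on_lines_coordinates:
  "poly_on_lines (\<lambda>x1 _ _ _. x1)" "poly_on_lines (\<lambda>_ x0 _ _. x0)"
  "poly_on_lines (\<lambda>_ _ y1 _. y1)" "poly_on_lines (\<lambda>_ _ _ y0. y0)"
proof -
  have "\<exists>p. \<forall>t. u + t * a = poly p t" for u a :: complex
    by (rule exI[of _ "[:u, a:]"]) simp
  then show "poly_on_lines (\<lambda>x1 _ _ _. x1)" "poly_on_lines (\<lambda>_ x0 _ _. x0)"
    "poly_on_lines (\<lambda>_ _ y1 _. y1)" "poly_on_lines (\<lambda>_ _ _ y0. y0)"
    by (simp_all add: poly_on_lines_def)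
qed

lemma poly_on_lines_add:
  assumes "poly_on_lines f" "poly_on_lines g"
  shows "poly_on_lines (\<lambda>x1 x0 y1 y0. f x1 x0 y1 y0 + g x1 x0 y1 y0)"
  using assms unfolding poly_on_lines_def by (metis poly_add)

lemma poly_on_lines_diff:
  assumes "poly_on_lines f" "poly_on_lines g"
  shows "poly_on_lines (\<lambda>x1 x0 y1 y0. f x1 x0 y1 y0 - g x1 x0 y1 y0)"
  using assms unfolding poly_on_lines_def by (metis poly_diff)

lemma poly_on_lines_mult:
  assumes "poly_on_lines f" "poly_on_lines g"
  shows "poly_on_lines (\<lambda>x1 x0 y1 y0. f x1 x0 y1 y0 * g x1 x0 y1 y0)"
  using assms unfolding poly_on_lines_def by (metis poly_mult)

lemma poly_on_lines_power:
  assumes "poly_on_lines f"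
  shows "poly_on_lines (\<lambda>x1 x0 y1 y0. f x1 x0 y1 y0 ^ m)"
  using assms unfolding poly_on_lines_def by (metis poly_power)

lemma poly_on_lines_sum:
  assumes "\<And>i. i \<in> A \<Longrightarrow> poly_on_lines (f i)"
  shows "poly_on_lines (\<lambda>x1 x0 y1 y0. \<Sum>i\<in>A. f i x1 x0 y1 y0)"
  using assms
  by (induction A rule: infinite_finite_induct)
    (simp_all add: poly_on_lines_const poly_on_lines_add)

lemma poly_on_lines_bihform: "poly_on_lines (bihform d e c)"
proof -
  have "poly_on_lines (\<lambda>x1 x0 y1 y0. \<Sum>i\<le>d. \<Sum>k\<le>e.
      c i k * x1 ^ i * x0 ^ (d - i) * y1 ^ k * y0 ^ (e - k))"
    by (intro poly_on_lines_sum poly_on_lines_mult poly_on_lines_power poly_on_lines_const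
        poly_on_lines_coordinates)
  then show ?thesis by (simp add: bihform_def[abs_def])
qed

text \<open>A polynomial in \<open>t\<close> that vanishes for \<open>t \<noteq> 0\<close> vanishes at \<open>0\<close>: the algebraic form of
  passing to the limit along a line.\<close>

lemma poly_on_lines_eq_0_limit:
  assumes f: "poly_on_lines f"
    and "\<And>t. t \<noteq> 0 \<Longrightarrow> f (x1 + t * a1) (x0 + t * a0) (y1 + t * b1) (y0 + t * b0) = 0"
  shows "f x1 x0 y1 y0 = 0"
proof -
  obtain p where p: "\<And>t. f (x1 + t * a1) (x0 + t * a0) (y1 + t * b1) (y0 + t * b0) = poly p t"
    using f unfolding poly_on_lines_def by metis
  with assms(2) have "- {0} \<subseteq> {t. poly p t = 0}" by auto
  moreover have "infinite (- {0 :: complex})"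
    using infinite_UNIV_char_0[where 'a = complex] by (simp add: finite_compl)
  ultimately have "p = 0"
    using poly_roots_finite[of p] finite_subset by blast
  with p[of 0] show ?thesis by simp
qed

text \<open>On the line that joins the given point to a point where \<open>g\<close> is nonzero, both functions are
  polynomials in one variable, and the second is not the zero polynomial.\<close>

lemma poly_on_lines_no_zero_divisors:
  assumes f: "poly_on_lines f" and g: "poly_on_lines g"
    and fg: "\<And>x1 x0 y1 y0. f x1 x0 y1 y0 * g x1 x0 y1 y0 = 0"
    and nz: "\<exists>w1 w0 z1 z0. g w1 w0 z1 z0 \<noteq> 0"
  shows "f x1 x0 y1 y0 = 0"
proof -
  obtain w1 w0 z1 z0 where w: "g w1 w0 z1 z0 \<noteq> 0" using nz by blast
  define L where "L h t = h (x1 + t * (w1 - x1)) (x0 + t * (w0 - x0))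
    (y1 + t * (z1 - y1)) (y0 + t * (z0 - y0))" 
    for h :: "complex \<Rightarrow> complex \<Rightarrow> complex \<Rightarrow> complex \<Rightarrow> complex" and t
  obtain p q where p: "\<And>t. L f t = poly p t" and q: "\<And>t. L g t = poly q t"
    using f g unfolding poly_on_lines_def L_def by metis
  have "poly (p * q) t = 0" for t
    using fg by (simp add: p[symmetric] q[symmetric] L_def)
  then have "p * q = 0" using poly_all_0_iff_0[of "p * q"] by blast
  moreover have "q \<noteq> 0" using q[of 1] w by (auto simp: L_def)
  ultimately have "p = 0" by simp
  with p[of 0] show ?thesis by (simp add: L_def)
qed

text \<open>The equivalence of tuples of forms that represent the same rational map, expressed by the vanishing of
  all \<open>2 \<times> 2\<close> minors.\<close>

definition proportional ::
  "nat \<Rightarrow> (nat \<Rightarrow> complex \<Rightarrow> complex \<Rightarrow> complex \<Rightarrow> complex \<Rightarrow> complex)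
     \<Rightarrow> (nat \<Rightarrow> complex \<Rightarrow> complex \<Rightarrow> complex \<Rightarrow> complex \<Rightarrow> complex) \<Rightarrow> bool" where
  "proportional n F G \<longleftrightarrow> (\<forall>u1 u0 v1 v0. \<forall>i\<le>n. \<forall>j\<le>n.
     F i u1 u0 v1 v0 * G j u1 u0 v1 v0 = F j u1 u0 v1 v0 * G i u1 u0 v1 v0)"

lemma proportionalD:
  assumes "proportional n F G" "i \<le> n" "j \<le> n"
  shows "F i u1 u0 v1 v0 * G j u1 u0 v1 v0 = F j u1 u0 v1 v0 * G i u1 u0 v1 v0"
  using assms by (simp add: proportional_def)

lemma proportional_sym: "proportional n F G \<Longrightarrow> proportional n G F"
  by (simp add: proportional_def mult.commute)

lemma minors_trans:
  fixes a b g :: "nat \<Rightarrow> complex"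
  assumes ga: "\<And>i j. i \<le> n \<Longrightarrow> j \<le> n \<Longrightarrow> g i * a j = g j * a i"
    and gb: "\<And>i j. i \<le> n \<Longrightarrow> j \<le> n \<Longrightarrow> g i * b j = g j * b i"
    and k: "k \<le> n" "g k \<noteq> 0" and ij: "i \<le> n" "j \<le> n"
  shows "a i * b j = a j * b i"
proof -
  have "a m = a k / g k * g m" "b m = b k / g k * g m" if "m \<le> n" for m
    using ga[OF k(1) that] gb[OF k(1) that] k by (simp_all add: field_simps)
  from this[OF ij(1)] this[OF ij(2)] show ?thesis by (metis mult.assoc mult.commute)
qed

text \<open>Where \<open>F k\<close> is nonzero this is \<open>minors_trans\<close>; multiplying the minors by \<open>(F k)^2\<close> and
  cancelling extends it to all points.\<close>

lemma proportional_trans: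
  assumes FG: "proportional n F G" and FH: "proportional n F H"
    and lns: "\<And>j. poly_on_lines (F j)" "\<And>j. poly_on_lines (G j)" "\<And>j. poly_on_lines (H j)"
    and nz: "k \<le> n" "F k w1 w0 z1 z0 \<noteq> 0"
  shows "proportional n G H"
  unfolding proportional_def
proof (intro allI impI)
  fix u1 u0 v1 v0 i j assume ij: "i \<le> n" "j \<le> n"
  have "(G i x1 x0 y1 y0 * H j x1 x0 y1 y0 - G j x1 x0 y1 y0 * H i x1 x0 y1 y0) *
      (F k x1 x0 y1 y0 * F k x1 x0 y1 y0) = 0" for x1 x0 y1 y0
    using minors_trans[where g = "\<lambda>i. F i x1 x0 y1 y0" and a = "\<lambda>i. G i x1 x0 y1 y0"
        and b = "\<lambda>i. H i x1 x0 y1 y0", OF proportionalD[OF FG] proportionalD[OF FH] nz(1) _ ij]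
    by (cases "F k x1 x0 y1 y0 = 0") simp_all
  then have "G i u1 u0 v1 v0 * H j u1 u0 v1 v0 - G j u1 u0 v1 v0 * H i u1 u0 v1 v0 = 0"
    using nz(2)
    by (intro poly_on_lines_no_zero_divisors[where
          f = "\<lambda>x1 x0 y1 y0. G i x1 x0 y1 y0 * H j x1 x0 y1 y0 - G j x1 x0 y1 y0 * H i x1 x0 y1 y0" and
          g = "\<lambda>x1 x0 y1 y0. F k x1 x0 y1 y0 * F k x1 x0 y1 y0"]
        poly_on_lines_diff poly_on_lines_mult lns) auto
  then show "G i u1 u0 v1 v0 * H j u1 u0 v1 v0 = G j u1 u0 v1 v0 * H i u1 u0 v1 v0" by simp
qed

section \<open>Zeros of binary forms\<close>

lemma form_zeros_cong:
  assumes "\<And>j. j \<le> n \<Longrightarrow> b j = b' j"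
  shows "form_zeros n b = form_zeros n b'"
proof -
  have "(\<Sum>j\<le>n. monom (b j) (n - j)) = (\<Sum>j\<le>n. monom (b' j) (n - j))"
    "(\<Sum>j\<le>n. monom (b j) j) = (\<Sum>j\<le>n. monom (b' j) j)"
    using assms by (auto intro: sum.cong)
  then show ?thesis by (simp add: form_zeros_def)
qed

lemma form_zeros_scale:
  assumes "c \<noteq> 0"
  shows "form_zeros n (\<lambda>j. c * b j) = form_zeros n b"
proof -
  have "(\<Sum>j\<le>n. monom (c * b j) (m j)) = smult c (\<Sum>j\<le>n. monom (b j) (m j))" for m
    by (rule poly_eqI) (auto simp: coeff_sum sum_distrib_left intro!: sum.cong)
  then show ?thesis using assms by (simp add: form_zeros_def order_smult)
qed

lemma form_zeros_proportional:
  assumes minors: "\<And>i j. i \<le> n \<Longrightarrow> j \<le> n \<Longrightarrow> b i * b' j = b j * b' i"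
    and "\<exists>j\<le>n. b j \<noteq> 0" "\<exists>j\<le>n. b' j \<noteq> 0"
  shows "form_zeros n b = form_zeros n b'"
proof -
  obtain k where k: "k \<le> n" "b k \<noteq> 0" using assms(2) by blast
  obtain l where l: "l \<le> n" "b' l \<noteq> 0" using assms(3) by blast
  have "b' k \<noteq> 0" using minors[OF k(1) l(1)] k l by auto
  have "form_zeros n b' = form_zeros n (\<lambda>j. b' k / b k * b j)"
  proof (rule form_zeros_cong)
    fix j assume "j \<le> n"
    from minors[OF k(1) this] k show "b' j = b' k / b k * b j" by (simp add: field_simps)
  qed
  also have "\<dots> = form_zeros n b"
    using k \<open>b' k \<noteq> 0\<close> by (intro form_zeros_scale) simp
  finally show ?thesis ..
qed

text \<open>The finite zeros suffice: they determine the dehomogenised polynomial, of which the \<open>b j\<close> are the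
  coefficients, up to its leading coefficient.\<close>

lemma form_zeros_eq_imp_proportional:
  assumes eq: "form_zeros n b = form_zeros n b'" and "i \<le> n" "j \<le> n"
  shows "b i * b' j = b j * b' i"
proof -
  define P where "P b = (\<Sum>j\<le>n. monom (b j) (n - j))" for b :: "nat \<Rightarrow> complex"
  have coeff: "coeff (P b) (n - j) = b j" if "j \<le> n" for b j
  proof -
    have "coeff (P b) (n - j) = (\<Sum>i\<le>n. if i = j then b i else 0)"
      unfolding P_def coeff_sum using that by (intro sum.cong) auto
    with that show ?thesis by simp
  qed
  have count: "count (form_zeros n b) (fin z) = count (proots (P b)) z" for b z
  proof -
    have "count (image_mset fin M) (fin z) = count M z" for M
      by (induction M) auto
    then show ?thesis by (simp add: form_zeros_def P_def)
  qed
  have "proots (P b) = proots (P b')"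
    by (rule multiset_eqI) (simp add: count[symmetric] eq)
  then have D: "\<exists>a. \<forall>m. coeff (P b'') m = a * coeff (\<Prod>x\<in>#proots (P b). [:- x, 1:]) m"
    if "b'' \<in> {b, b'}" for b''
    using complex_poly_decompose_multiset[of "P b''"] that
    by (intro exI[of _ "lead_coeff (P b'')"]) (metis coeff_smult insertE singletonD)
  obtain a a' where "\<And>m. coeff (P b) m = a * coeff (\<Prod>x\<in>#proots (P b). [:- x, 1:]) m"
    "\<And>m. coeff (P b') m = a' * coeff (\<Prod>x\<in>#proots (P b). [:- x, 1:]) m"
    using D[of b] D[of b'] by auto
  then show ?thesis
    unfolding coeff[OF assms(2), symmetric] coeff[OF assms(3), symmetric] by simp
qed

lemma form_zeros_split:
  assumes split: "\<And>z. (\<Sum>j\<le>n. b j * z ^ (n - j)) = a * (\<Prod>c\<in>C. z - r c)"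
    and "finite C" "a \<noteq> 0" "b 0 \<noteq> 0"
  shows "form_zeros n b = image_mset (\<lambda>c. fin (r c)) (mset_set C)"
proof -
  have "poly (\<Sum>j\<le>n. monom (b j) (n - j)) z = poly (smult a (\<Prod>c\<in>C. [:- r c, 1:])) z" for z
    using split[of z] by (simp add: poly_sum poly_monom poly_prod)
  then have "(\<Sum>j\<le>n. monom (b j) (n - j)) = smult a (\<Prod>c\<in>C. [:- r c, 1:])"
    by (simp only: poly_eq_poly_eq_iff[symmetric] fun_eq_iff) simp
  moreover have "proots (smult a (\<Prod>c\<in>C. [:- r c, 1:])) = image_mset r (mset_set C)"
    using assms by (simp add: proots_prod image_mset_mset_set_eq_sum)
  moreover have "order 0 (\<Sum>j\<le>n. monom (b j) j) = 0"
  proof (rule order_0I)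
    have "poly (\<Sum>j\<le>n. monom (b j) j) 0 = (\<Sum>j\<le>n. if j = 0 then b j else 0)"
      unfolding poly_sum by (intro sum.cong) (auto simp: poly_monom power_0_left)
    then show "poly (\<Sum>j\<le>n. monom (b j) j) 0 \<noteq> 0" using assms by simp
  qed
  ultimately show ?thesis by (simp add: form_zeros_def multiset.map_comp comp_def)
qed

lemma form_zeros_infty:
  assumes "\<And>j. j < n \<Longrightarrow> b j = 0" "b n \<noteq> 0"
  shows "form_zeros n b = replicate_mset n infty"
proof -
  have "(\<Sum>j\<le>n. monom (b j) (m j)) = monom (b n) (m n)" for m
    using assms by (subst sum.remove[of _ n]) (auto intro!: sum.neutral)
  moreover have "order 0 (monom (b n) n) = n"
  proof -
    have "monom (b n) n = smult (b n) ([:- 0, 1:] ^ n)"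
      by (simp add: monom_altdef)
    then show ?thesis
      using assms by (simp only: order_smult order_power_n_n not_False_eq_True)
  qed
  moreover have "proots (monom (b n) 0) = {#}" by (simp add: monom_0)
  ultimately show ?thesis by (simp add: form_zeros_def)
qed

section \<open>Coefficient forms\<close>

definition sum_coeff :: "nat \<Rightarrow> nat \<Rightarrow> nat \<Rightarrow> complex" where
  "sum_coeff n = (SOME \<gamma>. \<forall>x y z. (\<Prod>c\<in>unity_roots n. z - (x + c * y) ^ n) =
    (\<Sum>j\<le>n. hform j (\<gamma> j) (x ^ n) (y ^ n) * z ^ (n - j)))"

text \<open>The coefficient of \<open>z^(n - j)\<close> in the product is homogeneous of degree \<open>j\<close> in \<open>x^n\<close> and
  \<open>y^n\<close>, so only the entries with \<open>i + k = j\<close> of the bihomogenised form survive.\<close>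

definition mult_coeff :: "nat \<Rightarrow> nat \<Rightarrow> nat \<Rightarrow> nat \<Rightarrow> complex" where
  "mult_coeff n j i k = (if i + k = j then sum_coeff n j i else 0)"

abbreviation mult_form :: "nat \<Rightarrow> nat \<Rightarrow> complex \<Rightarrow> complex \<Rightarrow> complex \<Rightarrow> complex \<Rightarrow> complex" where
  "mult_form n j \<equiv> bihform n n (mult_coeff n j)"

lemma prod_eq_sum_coeff:
  assumes "n \<ge> 1"
  shows "(\<Prod>c\<in>unity_roots n. z - (x + c * y) ^ n) =
    (\<Sum>j\<le>n. hform j (sum_coeff n j) (x ^ n) (y ^ n) * z ^ (n - j))"
  using someI_ex[OF coset_sum_polynomial_expand[OF assms]] unfolding sum_coeff_def by blast

lemma sum_mult_0_power: "(\<Sum>i\<le>d. f i * (0 :: complex) ^ (d - i)) = f d"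
proof -
  have "(\<Sum>i\<le>d. f i * 0 ^ (d - i)) = (\<Sum>i\<le>d. if i = d then f i else 0)"
    by (intro sum.cong) (auto simp: power_0_left)
  then show ?thesis by simp
qed

lemma hform_0_right: "hform d c x 0 = c d * x ^ d"
  by (simp add: hform_def sum_mult_0_power)

lemma bihform_0_0: "bihform d e c x 0 y 0 = c d e * x ^ d * y ^ e"
proof -
  have "bihform d e c x 0 y 0 =
      (\<Sum>i\<le>d. \<Sum>k\<le>e. (c i k * x ^ i * 0 ^ (d - i) * y ^ k) * 0 ^ (e - k))"
    by (simp only: bihform_def)
  also have "\<dots> = (\<Sum>i\<le>d. (c i e * x ^ i * y ^ e) * 0 ^ (d - i))"
    by (simp only: sum_mult_0_power[where d = e]) (simp add: mult_ac)
  also have "\<dots> = c d e * x ^ d * y ^ e" by (rule sum_mult_0_power)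
  finally show ?thesis .
qed

lemma hform_0_left: "hform d c 0 y = c 0 * y ^ d"
proof -
  have "hform d c 0 y = (\<Sum>i\<le>d. if i = 0 then c i * y ^ d else 0)"
    unfolding hform_def by (intro sum.cong) (auto simp: power_0_left)
  then show ?thesis by simp
qed

text \<open>These three coefficients are what remains of the forms at \<open>\<infinity>\<close>. They are read off from
  \<open>(x, y, z) = (0, 0, 1)\<close>, \<open>(1, 0, 0)\<close> and \<open>(0, 1, 0)\<close>.\<close>

lemma sum_coeff_corners:
  assumes "n \<ge> 1"
  shows "sum_coeff n 0 0 = 1" "sum_coeff n n n = (- 1) ^ n" "sum_coeff n n 0 = (- 1) ^ n"
proof -
  have "(\<Sum>j\<le>n. hform j (sum_coeff n j) 0 0 * 1 ^ (n - j)) =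
      (\<Sum>j\<le>n. if j = 0 then sum_coeff n j 0 else 0)"
    by (intro sum.cong) (auto simp: hform_0_right power_0_left)
  with prod_eq_sum_coeff[OF assms, of 1 0 0] assms show "sum_coeff n 0 0 = 1"
    by (simp add: power_0_left)
  show "sum_coeff n n n = (- 1) ^ n"
    using prod_eq_sum_coeff[OF assms, of 0 1 0, unfolded sum_mult_0_power] assms
    by (simp add: hform_0_right power_0_left card_complex_roots_unity)
  have "(\<Prod>c\<in>unity_roots n. 0 - (0 + c * 1) ^ n) = (\<Prod>c\<in>unity_roots n. - 1)"
    by (intro prod.cong) auto
  with prod_eq_sum_coeff[OF assms, of 0 0 1, unfolded sum_mult_0_power] assms
  show "sum_coeff n n 0 = (- 1) ^ n"
    by (simp add: hform_0_left power_0_left card_complex_roots_unity)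
qed

lemma mult_form_eq:
  assumes "j \<le> n"
  shows "mult_form n j x1 x0 y1 y0 =
    (\<Sum>i\<le>j. sum_coeff n j i * x1 ^ i * x0 ^ (n - i) * y1 ^ (j - i) * y0 ^ (n - (j - i)))"
proof -
  have "mult_form n j x1 x0 y1 y0 = (\<Sum>i\<le>n. \<Sum>k\<le>n.
      if k = j - i then (if i \<le> j then
        sum_coeff n j i * x1 ^ i * x0 ^ (n - i) * y1 ^ k * y0 ^ (n - k) else 0) else 0)"
    unfolding bihform_def by (intro sum.cong refl) (auto simp: mult_coeff_def)
  also have "\<dots> = (\<Sum>i\<le>n. if i \<le> j then
      sum_coeff n j i * x1 ^ i * x0 ^ (n - i) * y1 ^ (j - i) * y0 ^ (n - (j - i)) else 0)"
    using assms by (intro sum.cong refl) (simp, arith)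
  also have "\<dots> = (\<Sum>i\<le>j. sum_coeff n j i * x1 ^ i * x0 ^ (n - i) * y1 ^ (j - i) * y0 ^ (n - (j - i)))"
    using assms by (intro sum.mono_neutral_cong_right) auto
  finally show ?thesis .
qed

lemma mult_form_affine:
  assumes "j \<le> n" "x0 \<noteq> 0" "y0 \<noteq> 0"
  shows "mult_form n j x1 x0 y1 y0 = x0 ^ n * y0 ^ n * hform j (sum_coeff n j) (x1 / x0) (y1 / y0)"
  unfolding mult_form_eq[OF assms(1)] hform_def sum_distrib_left
proof (rule sum.cong[OF refl])
  fix i assume "i \<in> {..j}"
  with assms have "x0 ^ n = x0 ^ (n - i) * x0 ^ i" "y0 ^ n = y0 ^ (n - (j - i)) * y0 ^ (j - i)"
    by (simp_all flip: power_add)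
  with assms show "sum_coeff n j i * x1 ^ i * x0 ^ (n - i) * y1 ^ (j - i) * y0 ^ (n - (j - i)) =
      x0 ^ n * y0 ^ n * (sum_coeff n j i * (x1 / x0) ^ i * (y1 / y0) ^ (j - i))"
    by (simp add: power_divide)
qed

lemma mult_form_0:
  assumes "n \<ge> 1"
  shows "mult_form n 0 x1 x0 y1 y0 = x0 ^ n * y0 ^ n"
  using sum_coeff_corners[OF assms] by (simp add: mult_form_eq)

lemma mult_form_infty_left:
  assumes "n \<ge> 1" "j \<le> n"
  shows "mult_form n j x1 0 y1 y0 = (if j = n then (- 1) ^ n * x1 ^ n * y0 ^ n else 0)"
proof -
  have "mult_form n j x1 0 y1 y0 =
      (\<Sum>i\<le>j. if i = n then sum_coeff n j i * x1 ^ n * y0 ^ n else 0)"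
    unfolding mult_form_eq[OF assms(2)] using assms by (intro sum.cong) (auto simp: power_0_left)
  with assms show ?thesis by (auto simp: sum_coeff_corners)
qed

lemma mult_form_infty_right:
  assumes "n \<ge> 1" "j \<le> n"
  shows "mult_form n j x1 x0 y1 0 = (if j = n then (- 1) ^ n * x0 ^ n * y1 ^ n else 0)"
proof -
  have "mult_form n j x1 x0 y1 0 =
      (\<Sum>i\<le>j. if i = 0 then (if j = n then sum_coeff n n 0 * x0 ^ n * y1 ^ n else 0) else 0)"
    unfolding mult_form_eq[OF assms(2)] using assms by (intro sum.cong) (auto simp: power_0_left)
  with assms show ?thesis by (auto simp: sum_coeff_corners)
qed

text \<open>At \<open>y = (-1)^n * x\<close> one of the factors \<open>(x' + c * y')^n\<close>, with \<open>x'\<close> and \<open>y'\<close> roots of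
  \<open>x\<close> and \<open>y\<close>, is zero, and the last form is up to sign their product.\<close>

lemma mult_form_antidiagonal:
  assumes "n \<ge> 1" "x0 \<noteq> 0"
  shows "mult_form n n x1 x0 ((- 1) ^ n * x1) x0 = 0"
proof -
  define x where "x = croot n (x1 / x0)"
  have x: "x ^ n = x1 / x0" using assms by (simp add: x_def croot_power)
  have "(\<Prod>c\<in>unity_roots n. 0 - (x + c * (- x)) ^ n) = 0"
    using assms finite_roots_unity[of n] by (intro prod_zero bexI[of _ 1]) auto
  then have "hform n (sum_coeff n n) (x ^ n) ((- x) ^ n) = 0"
    using prod_eq_sum_coeff[OF assms(1), of 0 x "- x"] by (simp only: sum_mult_0_power)
  moreover have "(- x) ^ n = (- 1) ^ n * x1 / x0"
    by (subst power_minus) (simp add: x)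
  ultimately show ?thesis using assms by (simp add: mult_form_affine x)
qed

lemma sum_mult_form_eq_prod:
  assumes "n \<ge> 1" "x0 \<noteq> 0" "y0 \<noteq> 0" "x ^ n = x1 / x0" "y ^ n = y1 / y0"
  shows "(\<Sum>j\<le>n. mult_form n j x1 x0 y1 y0 * z ^ (n - j)) =
    x0 ^ n * y0 ^ n * (\<Prod>c\<in>unity_roots n. z - (x + c * y) ^ n)"
  using assms by (simp add: prod_eq_sum_coeff mult_form_affine sum_distrib_left mult.assoc)

lemma p_coeffs_mult_coeff:
  assumes "n \<ge> 1"
  shows "p_coeffs n (mult_coeff n)"
  unfolding p_coeffs_def
proof (intro allI impI)
  fix x1 x0 y1 y0 z1 z0 :: complex
  assume nz: "x0 \<noteq> 0" "y0 \<noteq> 0" "z0 \<noteq> 0"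
  define x y where "x = croot n (x1 / x0)" and "y = croot n (y1 / y0)"
  have xy: "x ^ n = x1 / x0" "y ^ n = y1 / y0"
    using assms by (simp_all add: x_def y_def croot_power)
  have "(x0 * y0 * z0) ^ n * p_fun n (z1 / z0) ((- 1) ^ n * (x1 / x0)) ((- 1) ^ n * (y1 / y0)) =
      z0 ^ n * (x0 ^ n * y0 ^ n * (\<Prod>c\<in>unity_roots n. z1 / z0 - (x + c * y) ^ n))"
    unfolding xy[symmetric] p_fun_eq_prod[OF assms] by (simp add: power_mult_distrib)
  also have "\<dots> = z0 ^ n * (\<Sum>j\<le>n. mult_form n j x1 x0 y1 y0 * (z1 / z0) ^ (n - j))"
    using assms nz xy by (simp add: sum_mult_form_eq_prod)
  also have "\<dots> = (\<Sum>j\<le>n. mult_form n j x1 x0 y1 y0 * z1 ^ (n - j) * z0 ^ j)"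
    unfolding sum_distrib_left
  proof (rule sum.cong[OF refl])
    fix j assume "j \<in> {..n}"
    then have "z0 ^ n = z0 ^ (n - j) * z0 ^ j" by (simp flip: power_add)
    then show "z0 ^ n * (mult_form n j x1 x0 y1 y0 * (z1 / z0) ^ (n - j)) =
        mult_form n j x1 x0 y1 y0 * z1 ^ (n - j) * z0 ^ j"
      using nz by (simp add: power_divide)
  qed
  finally show "(x0 * y0 * z0) ^ n * p_fun n (z1 / z0) ((- 1) ^ n * (x1 / x0)) ((- 1) ^ n * (y1 / y0)) =
      (\<Sum>j\<le>n. mult_form n j x1 x0 y1 y0 * z1 ^ (n - j) * z0 ^ j)" .
qed

section \<open>Multiplication on the projective line\<close>

definition affine_coord :: "cp1 \<Rightarrow> complex" where
  "affine_coord p = (THE z. p = fin z)"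

lemma affine_coord_fin [simp]: "affine_coord (fin z) = z"
  by (simp add: affine_coord_def)

definition line_mult :: "nat \<Rightarrow> cp1 \<Rightarrow> cp1 \<Rightarrow> cp1 multiset option" where
  "line_mult n p q =
     (if p = infty \<and> q = infty then None
      else if p = infty \<or> q = infty then Some (replicate_mset n infty)
      else Some (image_mset fin (G_mult n (affine_coord p) (affine_coord q))))"

lemma line_mult_simps [simp]:
  "line_mult n (fin x) (fin y) = Some (image_mset fin (G_mult n x y))"
  "line_mult n infty (fin y) = Some (replicate_mset n infty)"
  "line_mult n (fin x) infty = Some (replicate_mset n infty)"
  "line_mult n infty infty = None"
  by (simp_all add: line_mult_def)

lemma pt_eq_infty_iff: "(x1, x0) \<noteq> (0, 0) \<Longrightarrow> pt x1 x0 = infty \<longleftrightarrow> x0 = 0"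
  by (auto simp: infty_def pt_eq_iff)

lemma pt_eq_fin: "x0 \<noteq> 0 \<Longrightarrow> pt x1 x0 = fin (x1 / x0)"
  by (simp add: fin_def pt_eq_iff)

text \<open>At finite points the dehomogenised form is a multiple of the product over the roots of unity. If one
  factor is \<open>\<infinity>\<close>, only the last form survives, and \<open>z0^n\<close> has \<open>\<infinity>\<close> as its only zero.\<close>

lemma line_mult_eq_form_zeros:
  assumes n: "n \<ge> 1" and xy: "(x1, x0) \<noteq> (0, 0)" "(y1, y0) \<noteq> (0, 0)" "x0 \<noteq> 0 \<or> y0 \<noteq> 0"
  shows "\<exists>j\<le>n. mult_form n j x1 x0 y1 y0 \<noteq> 0"
    and "line_mult n (pt x1 x0) (pt y1 y0) = Some (form_zeros n (\<lambda>j. mult_form n j x1 x0 y1 y0))"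
proof -
  consider "x0 = 0" "x1 \<noteq> 0" "y0 \<noteq> 0" | "y0 = 0" "y1 \<noteq> 0" "x0 \<noteq> 0" | "x0 \<noteq> 0" "y0 \<noteq> 0"
    using xy by auto
  then have "(\<exists>j\<le>n. mult_form n j x1 x0 y1 y0 \<noteq> 0) \<and>
    line_mult n (pt x1 x0) (pt y1 y0) = Some (form_zeros n (\<lambda>j. mult_form n j x1 x0 y1 y0))"
  proof cases
    case 1
    then have "pt x1 x0 = infty" by (simp add: pt_eq_infty_iff)
    with 1 n show ?thesis
      by (auto simp: pt_eq_fin mult_form_infty_left form_zeros_infty intro!: exI[of _ n])
  next
    case 2
    then have "pt y1 y0 = infty" by (simp add: pt_eq_infty_iff)
    with 2 n show ?thesis
      by (auto simp: pt_eq_fin mult_form_infty_right form_zeros_infty intro!: exI[of _ n])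
  next
    case 3
    define x y where "x = croot n (x1 / x0)" and "y = croot n (y1 / y0)"
    have xy: "x ^ n = x1 / x0" "y ^ n = y1 / y0"
      using n by (simp_all add: x_def y_def croot_power)
    have nz: "mult_form n 0 x1 x0 y1 y0 \<noteq> 0" using 3 n by (simp add: mult_form_0)
    have "form_zeros n (\<lambda>j. mult_form n j x1 x0 y1 y0) =
        image_mset (\<lambda>c. fin ((x + c * y) ^ n)) (mset_set (unity_roots n))"
      using 3 n xy nz finite_roots_unity[of n]
      by (intro form_zeros_split[where a = "x0 ^ n * y0 ^ n"] sum_mult_form_eq_prod) auto
    moreover have "image_mset fin (G_mult n (x1 / x0) (y1 / y0)) =
        image_mset (\<lambda>c. fin ((x + c * y) ^ n)) (mset_set (unity_roots n))"
      unfolding xy[symmetric] G_mult_powers[OF n] by (simp add: multiset.map_comp comp_def)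
    ultimately show ?thesis using 3 nz by (auto simp: pt_eq_fin)
  qed
  then show "\<exists>j\<le>n. mult_form n j x1 x0 y1 y0 \<noteq> 0"
    "line_mult n (pt x1 x0) (pt y1 y0) = Some (form_zeros n (\<lambda>j. mult_form n j x1 x0 y1 y0))"
    by blast+
qed

text \<open>Every tuple that represents the multiplication vanishes at \<open>(\<infinity>, \<infinity>)\<close>. Approaching that point
  with the first factor equal to \<open>\<infinity>\<close>, the entries other than the last must vanish; approaching it
  along \<open>y = (-1)^n * x\<close>, the last one must.\<close>

lemma proportional_mult_form_imp_0_at_infty:
  assumes n: "n \<ge> 1" and G: "proportional n (mult_form n) (\<lambda>j. bihform d e (G j))" and "j \<le> n"
  shows "bihform d e (G j) x1 0 y1 0 = 0"
proof -
  \<comment> \<open>The value at \<open>(\<infinity>, \<infinity>)\<close> depends on the coordinates only through a factor, so the two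
    approaches may end at different representatives of \<open>\<infinity>\<close>.\<close>
  have corner: "bihform d e (G j) x1 0 y1 0 = bihform d e (G j) 1 0 b 0 * (x1 ^ d * (y1 / b) ^ e)"
    if "b \<noteq> 0" for b
    using that by (simp add: bihform_0_0 power_divide)
  show ?thesis
  proof (cases "j = n")
    case False
    have "bihform d e (G j) (1 + t * 0) (0 + t * 0) (1 + t * 0) (0 + t * 1) = 0" if "t \<noteq> 0" for t
      using proportionalD[OF G _ \<open>j \<le> n\<close>, of n 1 0 1 t] n that False \<open>j \<le> n\<close>
      by (simp add: mult_form_infty_left)
    from poly_on_lines_eq_0_limit[OF poly_on_lines_bihform this]
    show ?thesis by (subst corner[of 1]) simp_all
  next
    case True
    have "bihform d e (G j) (1 + t * 0) (0 + t * 1) ((- 1) ^ n + t * 0) (0 + t * 1) = 0" if "t \<noteq> 0" for t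
      using proportionalD[OF G _ \<open>j \<le> n\<close>, of 0 1 t "(- 1) ^ n" t] n that True
        mult_form_antidiagonal[OF n that, of 1]
      by (simp add: mult_form_0)
    from poly_on_lines_eq_0_limit[OF poly_on_lines_bihform this]
    show ?thesis by (subst corner[of "(- 1) ^ n"]) simp_all
  qed
qed

section \<open>Rational maps\<close>

lemma rational_multimap_iff:
  "rational_multimap n f \<longleftrightarrow>
     (\<exists>d e F.
        (\<exists>x1 x0 y1 y0. \<exists>j\<le>n. bihform d e (F j) x1 x0 y1 y0 \<noteq> 0) \<and>
        (\<forall>x1 x0 y1 y0 A. (x1, x0) \<noteq> (0, 0) \<longrightarrow> (y1, y0) \<noteq> (0, 0) \<longrightarrow>
           (f (pt x1 x0) (pt y1 y0) = Some A \<longleftrightarrow>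
             (\<exists>d' e' G.
                proportional n (\<lambda>j. bihform d e (F j)) (\<lambda>j. bihform d' e' (G j)) \<and>
                (\<exists>j\<le>n. bihform d' e' (G j) x1 x0 y1 y0 \<noteq> 0) \<and>
                A = form_zeros n (\<lambda>j. bihform d' e' (G j) x1 x0 y1 y0)))))"
  unfolding rational_multimap_def proportional_def ..

lemma rational_multimap_line_mult:
  assumes n: "n \<ge> 1"
  shows "rational_multimap n (line_mult n)"
  unfolding rational_multimap_iff
proof (intro exI conjI allI impI)
  show "0 \<le> n" "mult_form n 0 0 1 0 1 \<noteq> 0" using n by (simp_all add: mult_form_0)
next
  fix x1 x0 y1 y0 :: complex and A
  assume xy: "(x1, x0) \<noteq> (0, 0)" "(y1, y0) \<noteq> (0, 0)"
  let ?G = "\<lambda>d e G. proportional n (mult_form n) (\<lambda>j. bihform d e (G j)) \<and>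
    (\<exists>j\<le>n. bihform d e (G j) x1 x0 y1 y0 \<noteq> 0) \<and>
    A = form_zeros n (\<lambda>j. bihform d e (G j) x1 x0 y1 y0)"
  show "line_mult n (pt x1 x0) (pt y1 y0) = Some A \<longleftrightarrow> (\<exists>d e G. ?G d e G)"
  proof (cases "x0 = 0 \<and> y0 = 0")
    case True
    with xy have "pt x1 x0 = infty" "pt y1 y0 = infty" by (simp_all add: pt_eq_infty_iff)
    moreover have "\<not> (\<exists>d e G. ?G d e G)"
      using True proportional_mult_form_imp_0_at_infty[OF n] by blast
    ultimately show ?thesis by simp
  next
    case False
    with xy have F: "\<exists>j\<le>n. mult_form n j x1 x0 y1 y0 \<noteq> 0"
      and mult: "line_mult n (pt x1 x0) (pt y1 y0) = Some (form_zeros n (\<lambda>j. mult_form n j x1 x0 y1 y0))"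
      using line_mult_eq_form_zeros[OF n, of x1 x0 y1 y0] by blast+
    show ?thesis
    proof
      assume "line_mult n (pt x1 x0) (pt y1 y0) = Some A"
      with mult F have "?G n n (mult_coeff n)" by (simp add: proportional_def mult.commute)
      then show "\<exists>d e G. ?G d e G" by blast
    next
      assume "\<exists>d e G. ?G d e G"
      then obtain d e G where G: "?G d e G" by blast
      then have "form_zeros n (\<lambda>j. mult_form n j x1 x0 y1 y0) = A"
        using F by (auto intro!: form_zeros_proportional dest: proportionalD)
      with mult show "line_mult n (pt x1 x0) (pt y1 y0) = Some A" by simp
    qed
  qed
qed

text \<open>At finite points the two representing tuples define the same multiset of zeros, so they are proportional
  there, and therefore everywhere. Proportional tuples define the same rational map, including its domain.\<close>

lemma rational_multimap_eqI:
  assumes f: "rational_multimap n f" and g: "rational_multimap n g"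
    and fg: "\<And>x y. f (fin x) (fin y) = g (fin x) (fin y)"
    and def: "\<And>x y. f (fin x) (fin y) \<noteq> None"
  shows "f = g"
proof -
  obtain d e F where F: "\<exists>x1 x0 y1 y0. \<exists>j\<le>n. bihform d e (F j) x1 x0 y1 y0 \<noteq> 0"
    and "\<forall>x1 x0 y1 y0 A. (x1, x0) \<noteq> (0, 0) \<longrightarrow> (y1, y0) \<noteq> (0, 0) \<longrightarrow>
      (f (pt x1 x0) (pt y1 y0) = Some A \<longleftrightarrow>
        (\<exists>d' e' G. proportional n (\<lambda>j. bihform d e (F j)) (\<lambda>j. bihform d' e' (G j)) \<and>
          (\<exists>j\<le>n. bihform d' e' (G j) x1 x0 y1 y0 \<noteq> 0) \<and>
          A = form_zeros n (\<lambda>j. bihform d' e' (G j) x1 x0 y1 y0)))"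
    using f[unfolded rational_multimap_iff] by - (erule exE, erule exE, erule exE, erule conjE, rule that)
  note f_iff = this(2)[rule_format]
  obtain k l H where H: "\<exists>x1 x0 y1 y0. \<exists>j\<le>n. bihform k l (H j) x1 x0 y1 y0 \<noteq> 0"
    and "\<forall>x1 x0 y1 y0 A. (x1, x0) \<noteq> (0, 0) \<longrightarrow> (y1, y0) \<noteq> (0, 0) \<longrightarrow>
      (g (pt x1 x0) (pt y1 y0) = Some A \<longleftrightarrow>
        (\<exists>d' e' G. proportional n (\<lambda>j. bihform k l (H j)) (\<lambda>j. bihform d' e' (G j)) \<and>
          (\<exists>j\<le>n. bihform d' e' (G j) x1 x0 y1 y0 \<noteq> 0) \<and>
          A = form_zeros n (\<lambda>j. bihform d' e' (G j) x1 x0 y1 y0)))"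
    using g[unfolded rational_multimap_iff] by - (erule exE, erule exE, erule exE, erule conjE, rule that)
  note g_iff = this(2)[rule_format]
  \<comment> \<open>The definition gives at each point possibly different tuples \<open>G1\<close> and \<open>G2\<close> that are nonzero
    there; proportionality passes from \<open>F\<close> through them to \<open>H\<close>.\<close>
  have affine_minors: "bihform d e (F i) x1 x0 y1 y0 * bihform k l (H j) x1 x0 y1 y0 =
      bihform d e (F j) x1 x0 y1 y0 * bihform k l (H i) x1 x0 y1 y0"
    if "x0 \<noteq> 0" "y0 \<noteq> 0" "i \<le> n" "j \<le> n" for x1 x0 y1 y0 i j
  proof -
    have nz: "(x1, x0) \<noteq> (0, 0)" "(y1, y0) \<noteq> (0, 0)" using that by auto
    have "f (pt x1 x0) (pt y1 y0) = g (pt x1 x0) (pt y1 y0)" "f (pt x1 x0) (pt y1 y0) \<noteq> None"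
      using that fg def by (simp_all add: pt_eq_fin)
    then obtain A where "f (pt x1 x0) (pt y1 y0) = Some A" "g (pt x1 x0) (pt y1 y0) = Some A" by auto
    then obtain d1 e1 G1 d2 e2 G2 where
      G1: "proportional n (\<lambda>j. bihform d e (F j)) (\<lambda>j. bihform d1 e1 (G1 j))"
      "\<exists>j\<le>n. bihform d1 e1 (G1 j) x1 x0 y1 y0 \<noteq> 0"
      "A = form_zeros n (\<lambda>j. bihform d1 e1 (G1 j) x1 x0 y1 y0)" and
      G2: "proportional n (\<lambda>j. bihform k l (H j)) (\<lambda>j. bihform d2 e2 (G2 j))"
      "\<exists>j\<le>n. bihform d2 e2 (G2 j) x1 x0 y1 y0 \<noteq> 0"
      "A = form_zeros n (\<lambda>j. bihform d2 e2 (G2 j) x1 x0 y1 y0)"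
      unfolding f_iff[OF nz] g_iff[OF nz] by blast
    obtain m1 m2 where m: "m1 \<le> n" "bihform d1 e1 (G1 m1) x1 x0 y1 y0 \<noteq> 0"
      "m2 \<le> n" "bihform d2 e2 (G2 m2) x1 x0 y1 y0 \<noteq> 0"
      using G1(2) G2(2) by blast
    have eq: "form_zeros n (\<lambda>j. bihform d1 e1 (G1 j) x1 x0 y1 y0) =
        form_zeros n (\<lambda>j. bihform d2 e2 (G2 j) x1 x0 y1 y0)"
      using G1(3) G2(3) by simp
    have FG2: "bihform d e (F i) x1 x0 y1 y0 * bihform d2 e2 (G2 j) x1 x0 y1 y0 =
        bihform d e (F j) x1 x0 y1 y0 * bihform d2 e2 (G2 i) x1 x0 y1 y0"
      if "i \<le> n" "j \<le> n" for i j
      by (rule minors_trans[where g = "\<lambda>j. bihform d1 e1 (G1 j) x1 x0 y1 y0",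
            OF proportionalD[OF proportional_sym[OF G1(1)]] form_zeros_eq_imp_proportional[OF eq]
            m(1,2) that])
    have G2F: "bihform d2 e2 (G2 i) x1 x0 y1 y0 * bihform d e (F j) x1 x0 y1 y0 =
        bihform d2 e2 (G2 j) x1 x0 y1 y0 * bihform d e (F i) x1 x0 y1 y0"
      if "i \<le> n" "j \<le> n" for i j
      using FG2[OF that] by (simp add: mult.commute)
    show ?thesis
      by (rule minors_trans[where g = "\<lambda>j. bihform d2 e2 (G2 j) x1 x0 y1 y0",
            OF G2F proportionalD[OF proportional_sym[OF G2(1)]] m(3,4) that(3,4)])
  qed
  have FH: "proportional n (\<lambda>j. bihform d e (F j)) (\<lambda>j. bihform k l (H j))"
    unfolding proportional_def
  proof (intro allI impI)
    fix u1 u0 v1 v0 i j assume ij: "i \<le> n" "j \<le> n"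
    let ?f = "\<lambda>x1 x0 y1 y0. bihform d e (F i) x1 x0 y1 y0 * bihform k l (H j) x1 x0 y1 y0 -
      bihform d e (F j) x1 x0 y1 y0 * bihform k l (H i) x1 x0 y1 y0"
    \<comment> \<open>The minors vanish where \<open>x0 * y0\<close> is nonzero, and \<open>x0 * y0\<close> is not a zero divisor.\<close>
    have "?f u1 u0 v1 v0 = 0"
    proof (rule poly_on_lines_no_zero_divisors[where f = ?f and g = "\<lambda>x1 x0 y1 y0. x0 * y0"])
      show "poly_on_lines ?f" "poly_on_lines (\<lambda>x1 x0 y1 y0. x0 * y0)"
        by (intro poly_on_lines_diff poly_on_lines_mult poly_on_lines_bihform poly_on_lines_coordinates)+
      show "?f x1 x0 y1 y0 * (x0 * y0) = 0" for x1 x0 y1 y0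
        using affine_minors[OF _ _ ij, of x0 y0 x1 y1] by auto
      show "\<exists>(w1 :: complex) w0 (z1 :: complex) z0. w0 * z0 \<noteq> (0 :: complex)"
        by (intro exI[of _ "1 :: complex"]) simp
    qed
    then show "bihform d e (F i) u1 u0 v1 v0 * bihform k l (H j) u1 u0 v1 v0 =
        bihform d e (F j) u1 u0 v1 v0 * bihform k l (H i) u1 u0 v1 v0" by simp
  qed
  have iff: "proportional n (\<lambda>j. bihform d e (F j)) (\<lambda>j. bihform d' e' (G j)) \<longleftrightarrow>
      proportional n (\<lambda>j. bihform k l (H j)) (\<lambda>j. bihform d' e' (G j))" for d' e' G
  proof -
    obtain w1 w0 z1 z0 j where F': "j \<le> n" "bihform d e (F j) w1 w0 z1 z0 \<noteq> 0" using F by blast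
    obtain w1' w0' z1' z0' j' where H': "j' \<le> n" "bihform k l (H j') w1' w0' z1' z0' \<noteq> 0"
      using H by blast
    show ?thesis (is "?P \<longleftrightarrow> ?Q")
    proof
      assume P: ?P
      show ?Q
        by (rule proportional_trans[OF FH P], (rule poly_on_lines_bihform)+, rule F'(1), rule F'(2))
    next
      assume Q: ?Q
      show ?P
        by (rule proportional_trans[OF proportional_sym[OF FH] Q], (rule poly_on_lines_bihform)+,
            rule H'(1), rule H'(2))
    qed
  qed
  have same: "f p q = Some A \<longleftrightarrow> g p q = Some A" for p q A
  proof -
    obtain x1 x0 where x: "(x1, x0) \<noteq> (0, 0)" "p = pt x1 x0" by (rule cp1_coords)
    obtain y1 y0 where y: "(y1, y0) \<noteq> (0, 0)" "q = pt y1 y0" by (rule cp1_coords)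
    show ?thesis unfolding x(2) y(2) f_iff[OF x(1) y(1)] g_iff[OF x(1) y(1)] iff ..
  qed
  show ?thesis
  proof (intro ext)
    fix p q
    show "f p q = g p q"
    proof (cases "g p q")
      case None
      with same[of p q] show ?thesis by (metis option.exhaust option.distinct(1))
    next
      case (Some A)
      with same[of p q A] show ?thesis by simp
    qed
  qed
qed

text \<open>At \<open>(1 : 0)\<close> a form takes the value of its highest coefficient. Dividing both forms by the largest
  common power of \<open>x0\<close> makes one of the two highest coefficients nonzero.\<close>

lemma rational_map_defined_at_infty:
  assumes "rational_map f"
  shows "\<exists>q. f infty = Some q"
proof -
  obtain d F1 F0 where nz: "\<exists>x1 x0. hform d F1 x1 x0 \<noteq> 0 \<or> hform d F0 x1 x0 \<noteq> 0"
    and "\<forall>x1 x0 q. (x1, x0) \<noteq> (0, 0) \<longrightarrow> (f (pt x1 x0) = Some q \<longleftrightarrow>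
      (\<exists>d' G1 G0.
        (\<forall>u1 u0. hform d F1 u1 u0 * hform d' G0 u1 u0 = hform d F0 u1 u0 * hform d' G1 u1 u0) \<and>
        (hform d' G1 x1 x0, hform d' G0 x1 x0) \<noteq> (0, 0) \<and>
        q = pt (hform d' G1 x1 x0) (hform d' G0 x1 x0)))"
    using assms[unfolded rational_map_def] by - (erule exE, erule exE, erule exE, erule conjE, rule that)
  note f = this(2)[rule_format]
  define P where "P i \<longleftrightarrow> i \<le> d \<and> (F1 i \<noteq> 0 \<or> F0 i \<noteq> 0)" for i
  define m where "m = (GREATEST i. P i)"
  have "\<exists>i. P i"
  proof (rule ccontr)
    assume "\<nexists>i. P i"
    then have "hform d F1 x1 x0 = 0 \<and> hform d F0 x1 x0 = 0" for x1 x0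
      by (auto simp: P_def hform_def intro!: sum.neutral)
    with nz show False by blast
  qed
  then have m: "P m" and above: "\<And>i. P i \<Longrightarrow> i \<le> m"
    unfolding m_def using GreatestI_ex_nat[of P d] Greatest_le_nat[of P _ d] by (auto simp: P_def)
  have factor: "hform d F x1 x0 = x0 ^ (d - m) * hform m F x1 x0" if "F = F1 \<or> F = F0" for F x1 x0
  proof -
    have "F i = 0" if "i \<le> d" "\<not> i \<le> m" for i
      using above[of i] that \<open>F = F1 \<or> F = F0\<close> by (auto simp: P_def)
    then have "hform d F x1 x0 = (\<Sum>i\<le>m. F i * x1 ^ i * x0 ^ (d - i))"
      unfolding hform_def using m by (intro sum.mono_neutral_right) (auto simp: P_def)
    also have "\<dots> = (\<Sum>i\<le>m. x0 ^ (d - m) * (F i * x1 ^ i * x0 ^ (m - i)))"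
    proof (rule sum.cong[OF refl])
      fix i assume "i \<in> {..m}"
      with m have "d - i = (d - m) + (m - i)" by (auto simp: P_def)
      then show "F i * x1 ^ i * x0 ^ (d - i) = x0 ^ (d - m) * (F i * x1 ^ i * x0 ^ (m - i))"
        by (simp add: power_add)
    qed
    finally show ?thesis by (simp add: hform_def sum_distrib_left)
  qed
  have "(hform m F1 1 0, hform m F0 1 0) \<noteq> (0, 0)"
    using m by (simp add: hform_0_right P_def)
  moreover have "\<forall>u1 u0. hform d F1 u1 u0 * hform m F0 u1 u0 = hform d F0 u1 u0 * hform m F1 u1 u0"
    by (simp add: factor)
  ultimately have "f (pt 1 0) = Some (pt (hform m F1 1 0) (hform m F0 1 0))"
    by (subst f) (simp, blast)
  then show ?thesis by (auto simp: infty_def)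
qed

lemma rational_map_monomial:
  assumes "f infty = infty" "\<And>z. f (fin z) = fin (c * z ^ d)" "c \<noteq> 0" "d \<ge> 1"
  shows "rational_map (\<lambda>u. Some (f u))"
proof -
  define F1 F0 :: "nat \<Rightarrow> complex"
    where "F1 i = (if i = d then c else 0)" and "F0 i = (if i = 0 then 1 else 0)" for i
  have F: "hform d F1 x1 x0 = c * x1 ^ d" "hform d F0 x1 x0 = x0 ^ d" for x1 x0
    by (simp_all add: hform_def F1_def F0_def if_distrib[of "\<lambda>u. u * _"] cong: if_cong)
  have nz: "(c * x1 ^ d, x0 ^ d) \<noteq> (0, 0)" if "(x1, x0) \<noteq> (0, 0)" for x1 x0 :: complex
    using that assms by auto
  have f: "f (pt x1 x0) = pt (c * x1 ^ d) (x0 ^ d)" if "(x1, x0) \<noteq> (0, 0)" for x1 x0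
  proof (cases "x0 = 0")
    case True
    with that assms nz[OF that] show ?thesis
      by (simp add: pt_eq_infty_iff[THEN iffD2])
  next
    case False
    with assms show ?thesis by (simp add: pt_eq_fin power_divide)
  qed
  show ?thesis
    unfolding rational_map_def
  proof (intro exI conjI allI impI)
    show "hform d F1 0 1 \<noteq> 0 \<or> hform d F0 0 1 \<noteq> 0" by (simp add: F)
  next
    fix x1 x0 q assume x: "(x1, x0) \<noteq> (0 :: complex, 0 :: complex)"
    let ?G = "\<lambda>e G1 G0.
      (\<forall>u1 u0. hform d F1 u1 u0 * hform e G0 u1 u0 = hform d F0 u1 u0 * hform e G1 u1 u0) \<and>
      (hform e G1 x1 x0, hform e G0 x1 x0) \<noteq> (0, 0) \<and>
      q = pt (hform e G1 x1 x0) (hform e G0 x1 x0)"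
    show "Some (f (pt x1 x0)) = Some q \<longleftrightarrow> (\<exists>e G1 G0. ?G e G1 G0)"
    proof
      assume "Some (f (pt x1 x0)) = Some q"
      then have "?G d F1 F0" using nz[OF x] f[OF x] by (simp add: F mult.commute)
      then show "\<exists>e G1 G0. ?G e G1 G0" by blast
    next
      assume "\<exists>e G1 G0. ?G e G1 G0"
      then obtain e G1 G0 where G: "?G e G1 G0" by blast
      then have "pt (c * x1 ^ d) (x0 ^ d) = pt (hform e G1 x1 x0) (hform e G0 x1 x0)"
        using nz[OF x] by (subst pt_eq_iff) (auto simp: F mult.commute)
      with G f[OF x] show "Some (f (pt x1 x0)) = Some q" by simp
    qed
  qed
qed

section \<open>Coset monoids\<close>

lemma nvalued_monoid_neutral_unique:
  assumes "nvalued_monoid n star e" "nvalued_monoid n star e'" "n \<ge> 1"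
  shows "e' = e"
proof -
  have "star e e' = Some (replicate_mset n e)" "star e e' = Some (replicate_mset n e')"
    using assms(1,2) unfolding nvalued_monoid_def by blast+
  then have "set_mset (replicate_mset n e) = set_mset (replicate_mset n e')" by simp
  with assms(3) show ?thesis by (simp add: set_mset_replicate_mset_subset)
qed

lemma subgroup_BijGroup_bij_betw_comp:
  assumes H: "subgroup H (BijGroup UNIV)" "finite H" and g: "g \<in> H"
  shows "bij_betw (\<lambda>h. g \<circ> h) H H"
proof -
  have Bij: "H \<subseteq> Bij UNIV" using subgroup.subset[OF H(1)] by (simp add: BijGroup_def)
  have "g \<circ> h \<in> H" if "h \<in> H" for h
    using subgroup.m_closed[OF H(1) g that] Bij g that
    by (auto simp: BijGroup_def compose_def comp_def subset_iff restrict_def)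
  moreover have "inj g" using Bij g by (auto simp: Bij_def bij_betw_def)
  then have "inj_on (\<lambda>h. g \<circ> h) H"
    by (rule inj_on_subset[OF fun.inj_map]) simp
  ultimately show ?thesis
    using H(2) by (simp add: bij_betw_def endo_inj_surj image_subset_iff)
qed

text \<open>Both triple products of \<open>\<pi> u\<close>, \<open>\<pi> v\<close>, \<open>\<pi> w\<close> consist of the \<open>\<pi> (u \<cdot> g v \<cdot> k w)\<close> with
  \<open>g\<close> and \<open>k\<close> in \<open>H\<close>: since \<open>g\<close> is an automorphism, \<open>u \<cdot> g (v \<cdot> h w) = (u \<cdot> g v) \<cdot> (g \<circ> h) w\<close>, and
  \<open>k = g \<circ> h\<close> runs through \<open>H\<close>. A coset product is defined only if all its constituents are, so
  the partiality of the covering monoid causes no loss.\<close>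

lemma coset_monoid_nvalued_monoid:
  assumes "is_coset_monoid n mul eM H proj star e"
  shows "nvalued_monoid n star e"
proof -
  have M: "nvalued_monoid 1 (as_onevalued mul) eM" and H: "subgroup H (BijGroup UNIV)" "finite H" "card H = n"
    and aut: "H \<subseteq> monoid_aut mul eM" and surj: "surj proj"
    and orbit: "\<And>u v. proj u = proj v \<longleftrightarrow> (\<exists>h\<in>H. v = h u)" and e: "e = proj eM"
    and star: "\<And>u v. star (proj u) (proj v) =
        (if \<forall>h\<in>H. mul u (h v) \<noteq> None
         then Some (image_mset (\<lambda>h. proj (the (mul u (h v)))) (mset_set H)) else None)"
    using assms unfolding is_coset_monoid_def by blast+
  have unit: "mul u eM = Some u" "mul eM u = Some u" for u
  proof -
    have "as_onevalued mul u eM = Some {#u#}" "as_onevalued mul eM u = Some {#u#}"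
      using M unfolding nvalued_monoid_def by (simp_all add: numeral_eq_Suc)
    then show "mul u eM = Some u" "mul eM u = Some u"
      by (auto simp: as_onevalued_def)
  qed
  have assoc: "mul u a = mul b w"
    if "mul v w = Some a" "mul u v = Some b" "mul u a \<noteq> None" "mul b w \<noteq> None" for u v w a b
  proof -
    have "as_onevalued mul v w = Some {#a#}" "as_onevalued mul u v = Some {#b#}"
      using that by (simp_all add: as_onevalued_def)
    then have "(\<Sum>x\<in>#{#a#}. the (as_onevalued mul u x)) = (\<Sum>x\<in>#{#b#}. the (as_onevalued mul x w))"
      using M that(3,4) unfolding nvalued_monoid_def
      by (elim conjE allE impE) (assumption, assumption, auto simp: as_onevalued_def)
    with that(3,4) show ?thesis by (auto simp: as_onevalued_def)
  qed
  have hom: "mul (h u) (h v) = map_option h (mul u v)" "h eM = eM" if "h \<in> H" for h u v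
    using aut that by (auto simp: monoid_aut_def)
  have starD: "mul u (h v) \<noteq> None" if "star (proj u) (proj v) \<noteq> None" "h \<in> H" for u v h
    using that by (auto simp: star split: if_splits)
  have star_eq: "star (proj u) (proj v) = Some (\<Sum>h\<in>H. {#proj (the (mul u (h v)))#})"
    if "star (proj u) (proj v) \<noteq> None" for u v
    using that by (auto simp: star image_mset_mset_set_eq_sum split: if_splits)
  have sum_image: "(\<Sum>w\<in>#(\<Sum>h\<in>H. {#p h#}). q w) = (\<Sum>h\<in>H. q (p h))"
    for p :: "('a \<Rightarrow> 'a) \<Rightarrow> 'b" and q :: "'b \<Rightarrow> 'b multiset"
    by (simp add: image_mset_mset_set_eq_sum[symmetric] multiset.map_comp comp_def sum_unfold_sum_mset)
  show ?thesis
    unfolding nvalued_monoid_def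
  proof (intro conjI allI impI)
    fix x y A assume "star x y = Some A"
    moreover obtain u v where "x = proj u" "y = proj v" using surj by (metis surjD)
    ultimately show "size A = n" using H by (auto simp: star split: if_splits)
  next
    fix x
    obtain u where x: "x = proj u" using surj by (metis surjD)
    have "image_mset (\<lambda>h. proj (the (mul u (h eM)))) (mset_set H) = image_mset (\<lambda>_. proj u) (mset_set H)"
      using H by (intro image_mset_cong) (auto simp: hom unit)
    then show "star x e = Some (replicate_mset n x)"
      using H by (auto simp: x e star hom unit image_mset_const_eq)
    have "proj (h u) = proj u" if "h \<in> H" for h using orbit[of u "h u"] that by auto
    then have "image_mset (\<lambda>h. proj (h u)) (mset_set H) = image_mset (\<lambda>_. proj u) (mset_set H)"
      using H by (intro image_mset_cong) auto
    then show "star e x = Some (replicate_mset n x)"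
      using H by (auto simp: x e star unit image_mset_const_eq)
  next
    fix x y z A B
    assume A: "star y z = Some A" and B: "star x y = Some B"
      and xA: "\<forall>w\<in>#A. star x w \<noteq> None" and Bz: "\<forall>w\<in>#B. star w z \<noteq> None"
    obtain u v w where xyz: "x = proj u" "y = proj v" "z = proj w" using surj by (metis surjD)
    have "\<exists>a. mul v (h w) = Some a" if "h \<in> H" for h
      using starD[of v w h] A xyz that by auto
    then obtain a where a: "\<And>h. h \<in> H \<Longrightarrow> mul v (h w) = Some (a h)" by metis
    have "\<exists>b. mul u (h v) = Some b" if "h \<in> H" for h
      using starD[of u v h] B xyz that by auto
    then obtain b where b: "\<And>h. h \<in> H \<Longrightarrow> mul u (h v) = Some (b h)" by metis
    have A_eq: "A = (\<Sum>h\<in>H. {#proj (a h)#})"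
      using star_eq[of v w] A a by (simp add: xyz)
    have B_eq: "B = (\<Sum>h\<in>H. {#proj (b h)#})"
      using star_eq[of u v] B b by (simp add: xyz)
    have xA': "star (proj u) (proj (a h)) \<noteq> None" and Bz': "star (proj (b h)) (proj w) \<noteq> None"
      if "h \<in> H" for h
      using xA Bz that H(2) by (auto simp: xyz A_eq B_eq image_mset_mset_set_eq_sum[symmetric])
    have "(\<Sum>w\<in>#A. the (star x w)) = (\<Sum>h\<in>H. \<Sum>g\<in>H. {#proj (the (mul u (g (a h))))#})"
      unfolding A_eq sum_image using xA' by (intro sum.cong) (auto simp: xyz star_eq)
    also have "\<dots> = (\<Sum>g\<in>H. \<Sum>h\<in>H. {#proj (the (mul u (g (a h))))#})"
      by (rule sum.swap)
    also have "\<dots> = (\<Sum>g\<in>H. \<Sum>h\<in>H. {#proj (the (mul (b g) ((g \<circ> h) w)))#})"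
    proof (intro sum.cong refl)
      fix g h assume gh: "g \<in> H" "h \<in> H"
      have "mul (g v) (g (h w)) = Some (g (a h))" using hom(1)[OF gh(1)] a[OF gh(2)] by simp
      moreover have "mul (b g) (g (h w)) \<noteq> None"
        using starD[OF Bz'[OF gh(1)], of "g \<circ> h"] bij_betwE[OF subgroup_BijGroup_bij_betw_comp[OF H(1,2) gh(1)]] gh
        by auto
      ultimately have "mul u (g (a h)) = mul (b g) (g (h w))"
        using assoc[OF _ b[OF gh(1)]] starD[OF xA'[OF gh(2)] gh(1)] by blast
      then show "{#proj (the (mul u (g (a h))))#} = {#proj (the (mul (b g) ((g \<circ> h) w)))#}" by simp
    qed
    also have "\<dots> = (\<Sum>g\<in>H. \<Sum>h\<in>H. {#proj (the (mul (b g) (h w)))#})"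
      by (intro sum.cong refl sum.reindex_bij_betw[OF subgroup_BijGroup_bij_betw_comp[OF H(1,2)]])
    also have "\<dots> = (\<Sum>w\<in>#B. the (star w z))"
      unfolding B_eq sum_image using Bz' by (intro sum.cong) (auto simp: xyz star_eq)
    finally show "(\<Sum>w\<in>#A. the (star x w)) = (\<Sum>w\<in>#B. the (star w z))" .
  qed
qed

section \<open>The projective line as a coset monoid\<close>

definition line_add :: "cp1 \<Rightarrow> cp1 \<Rightarrow> cp1 option" where
  "line_add p q =
     (if p = infty \<and> q = infty then None
      else if p = infty \<or> q = infty then Some infty
      else Some (fin (affine_coord p + affine_coord q)))"

definition line_scale :: "complex \<Rightarrow> cp1 \<Rightarrow> cp1" where
  "line_scale c p = (if p = infty then infty else fin (c * affine_coord p))"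

definition line_power :: "nat \<Rightarrow> cp1 \<Rightarrow> cp1" where
  "line_power n p = (if p = infty then infty else fin (affine_coord p ^ n))"

lemma line_add_simps [simp]:
  "line_add (fin x) (fin y) = Some (fin (x + y))" "line_add infty (fin y) = Some infty"
  "line_add (fin x) infty = Some infty" "line_add infty infty = None"
  by (simp_all add: line_add_def)

lemma line_scale_simps [simp]:
  "line_scale c (fin x) = fin (c * x)" "line_scale c infty = infty"
  by (simp_all add: line_scale_def)

lemma line_power_simps [simp]:
  "line_power n (fin x) = fin (x ^ n)" "line_power n infty = infty"
  by (simp_all add: line_power_def)

text \<open>This makes the algebraicity of the covering monoid the case \<open>n = 1\<close> of that of its quotient.\<close>

lemma as_onevalued_line_add: "as_onevalued line_add = line_mult 1"
proof (intro ext)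
  fix p q
  have "G_mult 1 x y = {#x + y#}" for x y
    using G_mult_powers[of 1 x y] by simp
  then show "as_onevalued line_add p q = line_mult 1 p q"
    by (cases p rule: cp1_cases; cases q rule: cp1_cases) (simp_all add: as_onevalued_def)
qed

lemma nvalued_monoid_line_add: "nvalued_monoid 1 (as_onevalued line_add) (fin 0)"
  unfolding nvalued_monoid_def as_onevalued_def
proof (intro conjI allI impI)
  fix x y z A B
  assume "map_option (\<lambda>w. {#w#}) (line_add y z) = Some A" "map_option (\<lambda>w. {#w#}) (line_add x y) = Some B"
    "\<forall>w\<in>#A. map_option (\<lambda>w. {#w#}) (line_add x w) \<noteq> None"
    "\<forall>w\<in>#B. map_option (\<lambda>w. {#w#}) (line_add w z) \<noteq> None"
  then show "(\<Sum>w\<in>#A. the (map_option (\<lambda>w. {#w#}) (line_add x w))) =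
      (\<Sum>w\<in>#B. the (map_option (\<lambda>w. {#w#}) (line_add w z)))"
    by (cases x rule: cp1_cases; cases y rule: cp1_cases; cases z rule: cp1_cases) (auto simp: add.assoc)
next
  fix x
  show "map_option (\<lambda>w. {#w#}) (line_add x (fin 0)) = Some (replicate_mset 1 x)"
    "map_option (\<lambda>w. {#w#}) (line_add (fin 0) x) = Some (replicate_mset 1 x)"
    by (cases x rule: cp1_cases; simp)+
qed auto

lemma line_scale_comp: "line_scale a \<circ> line_scale b = line_scale (a * b)"
proof
  fix p show "(line_scale a \<circ> line_scale b) p = line_scale (a * b) p"
    by (cases p rule: cp1_cases) simp_all
qed

lemma line_scale_1: "line_scale 1 = id"
proof
  fix p show "line_scale 1 p = id p" by (cases p rule: cp1_cases) simp_all
qed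

lemma bij_line_scale:
  assumes "c \<noteq> 0"
  shows "bij (line_scale c)"
  using assms by (intro o_bij[of "line_scale (inverse c)"]) (simp_all add: line_scale_comp line_scale_1)

lemma subgroup_line_scale:
  assumes "n \<ge> 1"
  shows "subgroup (line_scale ` unity_roots n) (BijGroup UNIV)"
proof -
  have nz: "c \<noteq> 0" if "c \<in> unity_roots n" for c using that assms by (auto simp: power_0_left)
  have Bij: "line_scale c \<in> Bij UNIV" if "c \<in> unity_roots n" for c
    using bij_line_scale[OF nz[OF that]] by (simp add: Bij_def)
  have mult: "line_scale a \<otimes>\<^bsub>BijGroup UNIV\<^esub> line_scale b = line_scale (a * b)"
    if "a \<in> unity_roots n" "b \<in> unity_roots n" for a b
  proof -
    have "compose UNIV (line_scale a) (line_scale b) = line_scale a \<circ> line_scale b"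
      by (simp add: compose_def comp_def restrict_def)
    then show ?thesis using Bij that by (simp add: BijGroup_def line_scale_comp)
  qed
  have one: "\<one>\<^bsub>BijGroup UNIV\<^esub> = line_scale 1" by (auto simp: BijGroup_def line_scale_1 restrict_def)
  interpret group "BijGroup (UNIV :: cp1 set)" by (rule group_BijGroup)
  show ?thesis
  proof (rule subgroupI)
    show "line_scale ` unity_roots n \<subseteq> carrier (BijGroup UNIV)"
      using Bij by (auto simp: BijGroup_def)
    show "line_scale ` unity_roots n \<noteq> {}"
      by (auto intro: exI[of _ 1])
  next
    fix h assume "h \<in> line_scale ` unity_roots n"
    then obtain c where c: "c \<in> unity_roots n" "h = line_scale c" by blast
    then have c': "inverse c \<in> unity_roots n" by (simp add: power_inverse)
    have "inv\<^bsub>BijGroup UNIV\<^esub> h = line_scale (inverse c)"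
      using Bij[OF c(1)] Bij[OF c'] mult[OF c' c(1)] nz[OF c(1)]
      by (intro inv_equality) (simp_all add: c(2) one, simp_all add: BijGroup_def)
    with c' show "inv\<^bsub>BijGroup UNIV\<^esub> h \<in> line_scale ` unity_roots n" by blast
  next
    fix h k assume "h \<in> line_scale ` unity_roots n" "k \<in> line_scale ` unity_roots n"
    then show "h \<otimes>\<^bsub>BijGroup UNIV\<^esub> k \<in> line_scale ` unity_roots n"
      using mult by (fastforce simp: power_mult_distrib)
  qed
qed

lemma is_coset_monoid_line:
  assumes n: "n \<ge> 1"
  shows "is_coset_monoid n line_add (fin 0) (line_scale ` unity_roots n) (line_power n) (line_mult n) (fin 0)"
proof -
  let ?H = "line_scale ` unity_roots n"
  have nz: "c \<noteq> 0" if "c \<in> unity_roots n" for c using that n by (auto simp: power_0_left)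
  have inj: "inj_on line_scale (unity_roots n)"
  proof (rule inj_onI)
    fix a b assume "line_scale a = line_scale b"
    then have "line_scale a (fin 1) = line_scale b (fin 1)" by simp
    then show "a = b" by simp
  qed
  have H: "finite ?H" "card ?H = n"
    using n finite_roots_unity[of n]
    by (auto simp: card_image[OF inj] card_complex_roots_unity intro!: finite_imageI)
  have aut: "?H \<subseteq> monoid_aut line_add (fin 0)"
  proof
    fix h assume "h \<in> ?H"
    then obtain c where c: "c \<in> unity_roots n" "h = line_scale c" by blast
    have "line_add (h u) (h v) = map_option h (line_add u v)" for u v
      by (cases u rule: cp1_cases; cases v rule: cp1_cases) (simp_all add: c distrib_left)
    with bij_line_scale[OF nz[OF c(1)]] show "h \<in> monoid_aut line_add (fin 0)"
      by (simp add: monoid_aut_def c)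
  qed
  have orbit: "line_power n u = line_power n v \<longleftrightarrow> (\<exists>h\<in>?H. v = h u)" for u v
  proof (cases u rule: cp1_cases; cases v rule: cp1_cases)
    fix x y assume uv: "u = fin x" "v = fin y"
    have "x ^ n = y ^ n \<longleftrightarrow> (\<exists>c\<in>unity_roots n. y = c * x)"
    proof (cases "x = 0")
      case True
      then show ?thesis using n by (auto simp: power_0_left intro!: exI[of _ 1])
    next
      case False
      then show ?thesis
        using n by (auto simp: power_mult_distrib power_divide power_0_left intro!: exI[of _ "y / x"])
    qed
    with uv show ?thesis by auto
  qed (auto intro!: exI[of _ 1])
  have "\<exists>u. p = line_power n u" for p
  proof (cases p rule: cp1_cases)
    case (fin z)
    then show ?thesis using n by (intro exI[of _ "fin (croot n z)"]) (simp add: croot_power)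
  qed (auto intro: exI[of _ infty])
  then have surj: "surj (line_power n)" unfolding surj_def by blast
  have mult: "line_mult n (line_power n u) (line_power n v) =
      (if \<forall>h\<in>?H. line_add u (h v) \<noteq> None
       then Some (image_mset (\<lambda>h. line_power n (the (line_add u (h v)))) (mset_set ?H)) else None)"
    for u v
  proof (cases u rule: cp1_cases; cases v rule: cp1_cases)
    fix x y assume uv: "u = fin x" "v = fin y"
    have "image_mset (\<lambda>h. line_power n (the (line_add u (h v)))) (mset_set ?H) =
        image_mset (\<lambda>c. fin ((x + c * y) ^ n)) (mset_set (unity_roots n))"
      unfolding image_mset_mset_set_eq_sum by (subst sum.reindex[OF inj]) (simp add: uv)
    then show ?thesis
      using n by (simp add: uv G_mult_powers multiset.map_comp comp_def)
  next
    fix y assume uv: "u = infty" "v = fin y"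
    have "image_mset (\<lambda>h. line_power n (the (line_add u (h v)))) (mset_set ?H) =
        image_mset (\<lambda>_. infty) (mset_set ?H)"
      using H by (intro image_mset_cong) (auto simp: uv)
    with H show ?thesis by (simp add: uv image_mset_const_eq)
  next
    fix x assume uv: "u = fin x" "v = infty"
    have "image_mset (\<lambda>h. line_power n (the (line_add u (h v)))) (mset_set ?H) =
        image_mset (\<lambda>_. infty) (mset_set ?H)"
      using H by (intro image_mset_cong) (auto simp: uv)
    with H show ?thesis by (simp add: uv image_mset_const_eq)
  next
    assume uv: "u = infty" "v = infty"
    have "(1 :: complex) \<in> unity_roots n" by simp
    then show ?thesis by (auto simp: uv simp del: mem_Collect_eq)
  qed
  show ?thesis
    unfolding is_coset_monoid_def
    using nvalued_monoid_line_add subgroup_line_scale[OF n] aut H surj orbit mult n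
    by (simp del: image_eqI)
qed

lemma algebraic_nvalued_monoid_line_mult:
  assumes "n \<ge> 1"
  shows "algebraic_nvalued_monoid n (line_mult n) (fin 0)"
  unfolding algebraic_nvalued_monoid_def
  using rational_multimap_line_mult[OF assms] coset_monoid_nvalued_monoid[OF is_coset_monoid_line[OF assms]]
  by blast

lemma algebraic_nvalued_coset_monoid_line_mult:
  assumes "n \<ge> 1"
  shows "algebraic_nvalued_coset_monoid n (line_mult n) (fin 0)"
  unfolding algebraic_nvalued_coset_monoid_def
proof (intro conjI exI ballI)
  show "algebraic_nvalued_monoid n (line_mult n) (fin 0)"
    by (rule algebraic_nvalued_monoid_line_mult[OF assms])
  show "is_coset_monoid n line_add (fin 0) (line_scale ` unity_roots n) (line_power n) (line_mult n) (fin 0)"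
    by (rule is_coset_monoid_line[OF assms])
  show "algebraic_nvalued_monoid 1 (as_onevalued line_add) (fin 0)"
    unfolding as_onevalued_line_add by (rule algebraic_nvalued_monoid_line_mult) simp
  show "rational_map (\<lambda>u. Some (line_power n u))"
    using assms by (intro rational_map_monomial[where c = 1 and d = n]) simp_all
next
  fix h assume "h \<in> line_scale ` unity_roots n"
  then obtain c where c: "c \<in> unity_roots n" "h = line_scale c" by blast
  then have "c \<noteq> 0" using assms by (auto simp: power_0_left)
  then show "rational_map (\<lambda>u. Some (h u))"
    unfolding c(2) by (intro rational_map_monomial[where c = c and d = 1]) simp_all
qed

lemma extension_unique:
  assumes "n \<ge> 1" "algebraic_nvalued_monoid n star e" "extends_G n star"
  shows "star = line_mult n \<and> e = fin 0"
proof -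
  have star: "star = line_mult n"
  proof (rule rational_multimap_eqI)
    show "rational_multimap n star" using assms(2) by (simp add: algebraic_nvalued_monoid_def)
    show "rational_multimap n (line_mult n)" by (rule rational_multimap_line_mult[OF assms(1)])
  qed (use assms(3) in \<open>simp_all add: extends_G_def\<close>)
  have "nvalued_monoid n (line_mult n) (fin 0)" "nvalued_monoid n (line_mult n) e"
    using assms(2) algebraic_nvalued_monoid_line_mult[OF assms(1)] star
    by (simp_all add: algebraic_nvalued_monoid_def)
  then have "e = fin 0" by (rule nvalued_monoid_neutral_unique[OF _ _ assms(1)])
  with star show ?thesis by blast
qed

text \<open>An inverse of \<open>\<infinity>\<close> would have to exist, but \<open>0\<close> is never in a product with \<open>\<infinity>\<close>.\<close>

lemma no_group_extension:
  assumes "n \<ge> 1" "algebraic_nvalued_group n star e iv" "extends_G n star"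
  shows False
proof -
  have star: "star = line_mult n" "e = fin 0"
    using extension_unique[OF assms(1) _ assms(3)] assms(2)
    by (auto simp: algebraic_nvalued_group_def)
  obtain y where "iv infty = Some y"
    using rational_map_defined_at_infty[of iv] assms(2) by (auto simp: algebraic_nvalued_group_def)
  then obtain A where "line_mult n infty y = Some A" "fin 0 \<in># A"
    using assms(2) star by (auto simp: algebraic_nvalued_group_def)
  then show False by (cases y rule: cp1_cases) (auto split: if_splits)
qed

theorem theorem9:
  fixes n :: nat
  assumes "n \<ge> 1"
  shows "\<exists>star.
      algebraic_nvalued_coset_monoid n star (fin 0) \<and> extends_G n star \<and>
      (\<forall>star' e'. algebraic_nvalued_monoid n star' e' \<and> extends_G n star' \<longrightarrow>
         star' = star \<and> e' = fin 0) \<and>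
      \<not> (\<exists>star' e' iv'. algebraic_nvalued_group n star' e' iv' \<and> extends_G n star') \<and>
      (\<forall>x. x \<noteq> infty \<longrightarrow>
         star infty x = Some (replicate_mset n infty) \<and>
         star x infty = Some (replicate_mset n infty)) \<and>
      star infty infty = None \<and>
      (\<exists>\<beta>. p_coeffs n \<beta> \<and>
         (\<forall>x1 x0 y1 y0. (x1, x0) \<noteq> (0, 0) \<longrightarrow> (y1, y0) \<noteq> (0, 0) \<longrightarrow>
            \<not> (pt x1 x0 = infty \<and> pt y1 y0 = infty) \<longrightarrow>
            (\<exists>j\<le>n. bihform n n (\<beta> j) x1 x0 y1 y0 \<noteq> 0) \<and>
            star (pt x1 x0) (pt y1 y0) =
              Some (form_zeros n (\<lambda>j. bihform n n (\<beta> j) x1 x0 y1 y0))))"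
proof (intro exI[of _ "line_mult n"] conjI)
  show "algebraic_nvalued_coset_monoid n (line_mult n) (fin 0)"
    by (rule algebraic_nvalued_coset_monoid_line_mult[OF assms])
  show "extends_G n (line_mult n)" by (simp add: extends_G_def)
  show "\<forall>star' e'. algebraic_nvalued_monoid n star' e' \<and> extends_G n star' \<longrightarrow>
      star' = line_mult n \<and> e' = fin 0"
    using extension_unique[OF assms] by blast
  show "\<not> (\<exists>star' e' iv'. algebraic_nvalued_group n star' e' iv' \<and> extends_G n star')"
    using no_group_extension[OF assms] by blast
  show "\<forall>x. x \<noteq> infty \<longrightarrow> line_mult n infty x = Some (replicate_mset n infty) \<and>
      line_mult n x infty = Some (replicate_mset n infty)"
    by (simp add: line_mult_def)
  show "line_mult n infty infty = None" by simp
  show "\<exists>\<beta>. p_coeffs n \<beta> \<and>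
      (\<forall>x1 x0 y1 y0. (x1, x0) \<noteq> (0, 0) \<longrightarrow> (y1, y0) \<noteq> (0, 0) \<longrightarrow>
         \<not> (pt x1 x0 = infty \<and> pt y1 y0 = infty) \<longrightarrow>
         (\<exists>j\<le>n. bihform n n (\<beta> j) x1 x0 y1 y0 \<noteq> 0) \<and>
         line_mult n (pt x1 x0) (pt y1 y0) =
           Some (form_zeros n (\<lambda>j. bihform n n (\<beta> j) x1 x0 y1 y0)))"
  proof (intro exI[of _ "mult_coeff n"] conjI[OF p_coeffs_mult_coeff[OF assms]] allI impI)
    fix x1 x0 y1 y0 :: complex
    assume xy: "(x1, x0) \<noteq> (0, 0)" "(y1, y0) \<noteq> (0, 0)" "\<not> (pt x1 x0 = infty \<and> pt y1 y0 = infty)"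
    then have "x0 \<noteq> 0 \<or> y0 \<noteq> 0"
      using pt_eq_infty_iff[OF xy(1)] pt_eq_infty_iff[OF xy(2)] by blast
    with line_mult_eq_form_zeros[OF assms xy(1,2)]
    show "(\<exists>j\<le>n. mult_form n j x1 x0 y1 y0 \<noteq> 0) \<and>
        line_mult n (pt x1 x0) (pt y1 y0) = Some (form_zeros n (\<lambda>j. mult_form n j x1 x0 y1 y0))"
      by blast
  qed
qed

end
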